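(* Let $G$ be a simple connected undirected graph with $n$ vertices, where $n\geq 4$ is even. Let $\theta(n)$ denote the largest real root of the equation $$x^3+(5-5n)x^2+(8n^2-25n+32)x-4n^3+22n^2-54n+48=0.$$ If $$\eta_1(G)<\begin{cases}\theta(n), & n=4 \text{ or } n\geq 12,\\[2pt] 2n+\sqrt{\frac{n(n+2)}{2}}-2, & n=6,8,10,\end{cases}$$ then $G$ contains a perfect matching.
   Context: For a connected graph $G$ with vertices $v_1,\dots,v_n$, the distance matrix $\mathcal{D}(G)$ is the $n\times n$ matrix whose $(i,j)$ entry is the distance (length of a shortest path) between $v_i$ and $v_j$. The transmission $Tr(v)$ of a vertex $v$ is the sum of the distances from $v$ to all vertices of $G$. The distance signless Laplacian matrix is $\mathcal{Q}(G)=\mathrm{Diag}(Tr)+\mathcal{D}(G)$, where $\mathrm{Diag}(Tr)$ is the diagonal matrix of vertex transmissions. $\eta_1(G)$ denotes the largest eigenvalue of $\mathcal{Q}(G)$ (the distance signless Laplacian spectral radius). A perfect matching is a set of pairwise vertex-disjoint edges covering every vertex of $G$. *)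

theory Defs
  imports "Graph_Theory.Graph_Theory" "Jordan_Normal_Form.Spectral_Radius"
begin

text \<open>
  A finite simple undirected graph is a \<open>pair_graph\<close>: a finite loop-free digraph
  whose arcs are ordered pairs of vertices and whose arc relation is symmetric. An
  undirected edge is represented by a pair of opposite arcs.
\<close>

definition gdist :: "'a pair_pre_digraph \<Rightarrow> 'a \<Rightarrow> 'a \<Rightarrow> nat" where
  "gdist G u v = (LEAST k. \<exists>p. pre_digraph.apath (with_proj G) u p v \<and> length p = k)"

definition transmission :: "'a pair_pre_digraph \<Rightarrow> 'a \<Rightarrow> nat" where
  "transmission G v = (\<Sum>u\<in>pverts G. gdist G v u)"

text \<open>
  The matrices depend on an enumeration \<open>vs\<close> of the vertices, that is, a distinct
  list with \<open>set vs = pverts G\<close>.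
\<close>

definition distance_matrix :: "'a pair_pre_digraph \<Rightarrow> 'a list \<Rightarrow> real mat" where
  "distance_matrix G vs =
     mat (length vs) (length vs) (\<lambda>(i, j). real (gdist G (vs ! i) (vs ! j)))"

definition transmission_matrix :: "'a pair_pre_digraph \<Rightarrow> 'a list \<Rightarrow> real mat" where
  "transmission_matrix G vs =
     mat (length vs) (length vs) (\<lambda>(i, j). if i = j then real (transmission G (vs ! i)) else 0)"

definition distance_signless_laplacian :: "'a pair_pre_digraph \<Rightarrow> 'a list \<Rightarrow> real mat" where
  "distance_signless_laplacian G vs = transmission_matrix G vs + distance_matrix G vs"

text \<open>
  The matrix is real symmetric, so all its eigenvalues are real and the maximum over
  the real spectrum (finite, and nonempty when there are vertices) is the largest eigenvalue.
\<close>

definition eta1 :: "'a pair_pre_digraph \<Rightarrow> 'a list \<Rightarrow> real" where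
  "eta1 G vs = Max (spectrum (distance_signless_laplacian G vs))"

definition theta :: "nat \<Rightarrow> real" where
  "theta n = Max {x :: real.
     x ^ 3 + (5 - 5 * real n) * x ^ 2 + (8 * real n ^ 2 - 25 * real n + 32) * x
       - 4 * real n ^ 3 + 22 * real n ^ 2 - 54 * real n + 48 = 0}"

definition undirected_edges :: "'a pair_pre_digraph \<Rightarrow> 'a set set" where
  "undirected_edges G = {{u, v} | u v. (u, v) \<in> parcs G}"

definition perfect_matching :: "'a pair_pre_digraph \<Rightarrow> 'a set set \<Rightarrow> bool" where
  "perfect_matching G M \<longleftrightarrow>
     M \<subseteq> undirected_edges G \<and> pairwise disjnt M \<and> \<Union>M = pverts G"

end

theory Submission
  imports Defs
begin

text \<open>
  If there is no perfect matching, Tutte's theorem and parity give a set \<open>S\<close> of \<open>s\<close> vertices such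
  that the remaining vertices split into \<open>s + 2\<close> odd parts with no edges between different parts;
  connectedness forces \<open>s \<ge> 1\<close>. Distinct vertices are at distance at least 1, and at least 2 if
  they lie in different parts, which bounds the quadratic form
  \<open>\<Sum> d(u, v) (x\<^sub>u + x\<^sub>v)\<^sup>2\<close> of the distance signless Laplacian from below. Suitably
  transferred test vectors make this at least the form of the join of \<open>K\<^sub>s\<close> with
  \<open>K\<^sub>m \<union> (s + 1) K\<^sub>1\<close>, where \<open>m = n - 2 s - 1\<close>. A test vector solving two of the three
  eigenvalue equations of that graph (one per block) for the threshold value \<open>l\<close>
  has Rayleigh quotient at least \<open>l\<close> as soon as the cubic of the graph is nonpositive at \<open>l\<close>. For
  \<open>s = 1\<close> this is the cubic defining \<open>theta n\<close>; for \<open>s = n / 2 - 1\<close> it has the root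
  \<open>2 n + sqrt (n (n + 2) / 2) - 2\<close>.
\<close>

section \<open>Tutte's theorem\<close>

text \<open>Induction on the number of sets, after Halmos and Vaughan. If some nonempty proper
  subfamily is tight, it and the remaining sets are matched separately; otherwise every such
  subfamily has an element to spare, so one representative can be chosen arbitrarily.\<close>

theorem hall_marriage:
  fixes A :: "'i \<Rightarrow> 'a set"
  assumes "finite I" and "\<And>i. i \<in> I \<Longrightarrow> finite (A i)"
    and "\<And>J. J \<subseteq> I \<Longrightarrow> card J \<le> card (\<Union>(A ` J))"
  shows "\<exists>f. inj_on f I \<and> (\<forall>i\<in>I. f i \<in> A i)"
  using assms
proof (induction "card I" arbitrary: I A rule: less_induct)
  case less
  note fin = less.prems(1,2) and hall = less.prems(3)
  show ?case
  proof (cases "\<exists>J. J \<subset> I \<and> J \<noteq> {} \<and> card (\<Union>(A ` J)) = card J")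
    case True
    then obtain J where J: "J \<subset> I" "J \<noteq> {}" and tight: "card (\<Union>(A ` J)) = card J" by blast
    have finJ: "finite J" using J fin finite_subset by blast
    define B where "B i = A i - \<Union>(A ` J)" for i
    have "\<exists>f. inj_on f J \<and> (\<forall>i\<in>J. f i \<in> A i)"
    proof (rule less.hyps)
      show "card J < card I" using J fin by (simp add: psubset_card_mono)
      show "finite J" by (fact finJ)
      show "\<And>i. i \<in> J \<Longrightarrow> finite (A i)" using fin J by blast
      show "\<And>K. K \<subseteq> J \<Longrightarrow> card K \<le> card (\<Union>(A ` K))" using hall J by blast
    qed
    then obtain f where f: "inj_on f J" "\<forall>i\<in>J. f i \<in> A i" by blast
    have "\<exists>g. inj_on g (I - J) \<and> (\<forall>i\<in>I - J. g i \<in> B i)"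
    proof (rule less.hyps)
      show "card (I - J) < card I" using J fin by (intro psubset_card_mono) auto
      show "finite (I - J)" using fin by simp
      show "\<And>i. i \<in> I - J \<Longrightarrow> finite (B i)" using fin by (simp add: B_def)
      show "card K \<le> card (\<Union>(B ` K))" if K: "K \<subseteq> I - J" for K
      proof -
        have finK: "finite K" using K fin finite_subset by blast
        \<comment> \<open>Hall's condition for \<open>K \<union> J\<close> passes to
          \<open>K\<close> because, by tightness, the elements withheld from the sets
          \<open>B i\<close> number exactly \<open>card J\<close>.\<close>
        have "card K + card J = card (K \<union> J)"
          using K finK finJ by (subst card_Un_disjoint) auto
        also have "\<dots> \<le> card (\<Union>(A ` (K \<union> J)))" using K J by (intro hall) blast
        also have "\<Union>(A ` (K \<union> J)) = \<Union>(B ` K) \<union> \<Union>(A ` J)" by (auto simp: B_def)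
        also have "card \<dots> \<le> card (\<Union>(B ` K)) + card (\<Union>(A ` J))" by (rule card_Un_le)
        finally show ?thesis using tight by simp
      qed
    qed
    then obtain g where g: "inj_on g (I - J)" "\<forall>i\<in>I - J. g i \<in> B i" by blast
    define h where "h i = (if i \<in> J then f i else g i)" for i
    have cross: "h i \<noteq> h j" if "i \<in> J" "j \<in> I - J" for i j
      using f(2) g(2) that by (auto simp: h_def B_def)
    have "inj_on h I"
    proof (rule inj_onI)
      fix i j assume "i \<in> I" "j \<in> I" and eq: "h i = h j"
      then consider "i \<in> J" "j \<in> J" | "i \<in> I - J" "j \<in> I - J"
        using cross[of i j] cross[of j i] by auto
      then show "i = j"
        by cases (use eq f(1) g(1) in \<open>auto simp: h_def dest: inj_onD\<close>)
    qed
    moreover have "\<forall>i\<in>I. h i \<in> A i" using f g by (auto simp: h_def B_def)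
    ultimately show ?thesis by blast
  next
    case no_tight: False
    show ?thesis
    proof (cases "I = {}")
      case True
      then show ?thesis by auto
    next
      case False
      then obtain i where i: "i \<in> I" by blast
      have "card {i} \<le> card (\<Union>(A ` {i}))" using i by (intro hall) simp
      then obtain x where x: "x \<in> A i" by (cases "A i = {}") auto
      have "\<exists>f. inj_on f (I - {i}) \<and> (\<forall>j\<in>I - {i}. f j \<in> A j - {x})"
      proof (rule less.hyps)
        show "card (I - {i}) < card I" using i fin(1) by (meson card_Diff1_less)
        show "finite (I - {i})" using fin by simp
        show "\<And>j. j \<in> I - {i} \<Longrightarrow> finite (A j - {x})" using fin by simp
        show "card K \<le> card (\<Union>j\<in>K. A j - {x})" if K: "K \<subseteq> I - {i}" for K
        proof (cases "K = {}")
          case False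
          have "K \<subset> I" using K i by blast
          with False no_tight have "card (\<Union>(A ` K)) \<noteq> card K" by blast
          moreover have "card K \<le> card (\<Union>(A ` K))" using K by (intro hall) blast
          ultimately have "card K < card (\<Union>(A ` K))" by simp
          moreover have "(\<Union>j\<in>K. A j - {x}) = \<Union>(A ` K) - {x}" by blast
          moreover have "card (\<Union>(A ` K)) \<le> Suc (card (\<Union>(A ` K) - {x}))"
            using diff_card_le_card_Diff[of "{x}" "\<Union>(A ` K)"] by simp
          ultimately show ?thesis by simp
        qed simp
      qed
      then obtain f where f: "inj_on f (I - {i})" "\<forall>j\<in>I - {i}. f j \<in> A j - {x}" by blast
      have "inj_on (f(i := x)) I" using f by (auto simp: inj_on_def)
      moreover have "\<forall>j\<in>I. (f(i := x)) j \<in> A j" using f x by auto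
      ultimately show ?thesis by blast
    qed
  qed
qed

text \<open>Parts need not be connected: for symmetric \<open>E\<close> each is a union of
  components of the graph on \<open>A\<close>.\<close>

definition separated_partition :: "('a \<Rightarrow> 'a \<Rightarrow> bool) \<Rightarrow> 'a set \<Rightarrow> 'a set set \<Rightarrow> bool" where
  "separated_partition E A P \<longleftrightarrow>
     partition_on A P \<and> (\<forall>C\<in>P. \<forall>D\<in>P. C \<noteq> D \<longrightarrow> (\<forall>x\<in>C. \<forall>y\<in>D. \<not> E x y))"

definition odd_parts :: "'a set set \<Rightarrow> 'a set set" where
  "odd_parts P = {C \<in> P. odd (card C)}"

text \<open>Phrased for a relation and a vertex set so that induction can pass to subsets;
  \<open>\<Union>M = V\<close> keeps all edges inside \<open>V\<close>, so \<open>E\<close> itself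
  never has to be restricted.\<close>

definition perfect_matching_on :: "('a \<Rightarrow> 'a \<Rightarrow> bool) \<Rightarrow> 'a set \<Rightarrow> 'a set set \<Rightarrow> bool" where
  "perfect_matching_on E V M \<longleftrightarrow>
     M \<subseteq> {{u, v} | u v. E u v} \<and> pairwise disjnt M \<and> \<Union>M = V"

section \<open>Gluing matchings and counting parts\<close>

lemma perfect_matching_on_UN:
  assumes "\<And>i. i \<in> I \<Longrightarrow> perfect_matching_on E (V i) (M i)"
    and "\<And>i j. i \<in> I \<Longrightarrow> j \<in> I \<Longrightarrow> i \<noteq> j \<Longrightarrow> V i \<inter> V j = {}"
  shows "perfect_matching_on E (\<Union>i\<in>I. V i) (\<Union>i\<in>I. M i)"
proof -
  have "disjnt e f" if "i \<in> I" "j \<in> I" "e \<in> M i" "f \<in> M j" "e \<noteq> f" for i j e f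
  proof (cases "i = j")
    case True
    then show ?thesis using that assms(1)[of i] by (auto simp: perfect_matching_on_def pairwise_def)
  next
    case False
    moreover have "e \<subseteq> V i" "f \<subseteq> V j" using that assms(1) by (auto simp: perfect_matching_on_def)
    ultimately show ?thesis using assms(2)[of i j] that by (auto simp: disjnt_def)
  qed
  then have "pairwise disjnt (\<Union>i\<in>I. M i)" by (auto simp: pairwise_def)
  moreover have "(\<Union>i\<in>I. M i) \<subseteq> {{u, v} | u v. E u v}"
    using assms(1) unfolding perfect_matching_on_def by (intro UN_least) simp
  moreover have "\<Union>(M i) = V i" if "i \<in> I" for i
    using assms(1)[OF that] by (simp add: perfect_matching_on_def)
  then have "\<Union>(\<Union>i\<in>I. M i) = (\<Union>i\<in>I. V i)" by blast
  ultimately show ?thesis by (simp add: perfect_matching_on_def)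
qed

lemma perfect_matching_on_insert:
  assumes "perfect_matching_on E V M" "E u v" "u \<notin> V" "v \<notin> V"
  shows "perfect_matching_on E (insert u (insert v V)) (insert {u, v} M)"
  using assms by (auto simp: perfect_matching_on_def pairwise_insert disjnt_def)

lemma card_eq_sum_partition_on:
  assumes "finite A" "partition_on A P"
  shows "card A = (\<Sum>C\<in>P. card C)"
proof -
  have "\<And>C. C \<in> P \<Longrightarrow> finite C"
    using assms by (metis Sup_upper finite_subset partition_onD1)
  then show ?thesis
    using assms card_Union_disjoint[of P] by (auto simp: partition_on_def)
qed

lemma card_partition_on_le:
  assumes "finite A" "partition_on A P"
  shows "card P \<le> card A"
proof -
  have "1 \<le> card C" if "C \<in> P" for C
  proof -
    have "C \<subseteq> A" "C \<noteq> {}" using that assms(2) by (auto simp: partition_on_def)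
    then have "finite C" "C \<noteq> {}" using assms(1) finite_subset by blast+
    then show ?thesis by (simp add: Suc_leI card_gt_0_iff)
  qed
  then have "(\<Sum>C\<in>P. 1) \<le> (\<Sum>C\<in>P. card C)" by (intro sum_mono)
  then show ?thesis using card_eq_sum_partition_on[OF assms] by simp
qed

text \<open>Modulo 2 the sum of the part sizes counts the odd parts. In \<open>tutte\<close> this
  turns an excess of one odd part into an excess of at least two.\<close>

lemma even_card_odd_parts_iff:
  assumes "finite A" "partition_on A P"
  shows "even (card (odd_parts P)) \<longleftrightarrow> even (card A)"
  using finite_elements[OF assms]
  by (simp add: card_eq_sum_partition_on[OF assms] even_sum_iff odd_parts_def)

lemma separated_partitionI:
  assumes "\<Union>P = A" "{} \<notin> P"
    and "\<And>C D. C \<in> P \<Longrightarrow> D \<in> P \<Longrightarrow> C \<noteq> D \<Longrightarrow> C \<inter> D = {}"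
    and "\<And>C D x y. C \<in> P \<Longrightarrow> D \<in> P \<Longrightarrow> C \<noteq> D \<Longrightarrow> x \<in> C \<Longrightarrow> y \<in> D \<Longrightarrow> \<not> E x y"
  shows "separated_partition E A P"
  unfolding separated_partition_def
proof (intro conjI ballI impI)
  show "partition_on A P"
    using assms(1-3) by (intro partition_onI) (simp_all add: disjnt_def)
qed (rule assms(4))

lemma separated_partitionD:
  assumes "separated_partition E A P"
  shows "\<Union>P = A" "{} \<notin> P"
    and "\<And>C D. C \<in> P \<Longrightarrow> D \<in> P \<Longrightarrow> C \<noteq> D \<Longrightarrow> C \<inter> D = {}"
    and "\<And>C D x y. C \<in> P \<Longrightarrow> D \<in> P \<Longrightarrow> C \<noteq> D \<Longrightarrow> x \<in> C \<Longrightarrow> y \<in> D \<Longrightarrow> \<not> E x y"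
  using assms by (simp_all add: separated_partition_def partition_on_def pairwise_def disjnt_def)

text \<open>Counting odd parts of arbitrary separated partitions instead of odd components loses nothing,
  because refining such a partition never decreases the number of its odd parts.\<close>

theorem tutte:
  fixes E :: "'a \<Rightarrow> 'a \<Rightarrow> bool"
  assumes "finite V" and "symp E"
    and "\<And>S P. S \<subseteq> V \<Longrightarrow> separated_partition E (V - S) P \<Longrightarrow> card (odd_parts P) \<le> card S"
  shows "\<exists>M. perfect_matching_on E V M"
  using assms
proof (induction "card V" arbitrary: V rule: less_induct)
  case less
  note finV = less.prems(1) and sym = less.prems(2) and tutte = less.prems(3)
  \<comment> \<open>A barrier attains equality in Tutte's condition. One with \<open>card S\<close>
    as large as possible is chosen below; the empty set starts the search, since the condition for
    \<open>S = {}\<close> excludes that \<open>card V\<close> is odd.\<close>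
  define barrier where "barrier S P \<longleftrightarrow> S \<subseteq> V \<and> separated_partition E (V - S) P \<and>
    card (odd_parts P) = card S" for S P
  have "\<exists>P. barrier {} P"
  proof (cases "V = {}")
    case True
    then have "barrier {} {}"
      by (auto simp: barrier_def separated_partition_def odd_parts_def partition_on_empty)
    then show ?thesis ..
  next
    case False
    then have P: "separated_partition E (V - {}) {V}"
      by (auto simp: separated_partition_def intro: partition_on_space)
    then have "card (odd_parts {V}) = card ({} :: 'a set)" using tutte[of "{}" "{V}"] by simp
    with P have "barrier {} {V}" unfolding barrier_def by blast
    then show ?thesis ..
  qed
  then obtain P0 where "barrier {} P0" ..
  then have "\<exists>x. (\<lambda>(S, P). barrier S P) x \<and>
      (\<forall>y. (\<lambda>(S, P). barrier S P) y \<longrightarrow> card (fst y) \<le> card (fst x))"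
    using card_mono[OF finV]
    by (intro ex_has_greatest_nat[where k = "({}, P0)" and b = "Suc (card V)"])
       (auto simp: barrier_def less_Suc_eq_le)
  then obtain S P where SP: "barrier S P"
    and max: "\<And>S' P'. barrier S' P' \<Longrightarrow> card S' \<le> card S" by fastforce
  have SV: "S \<subseteq> V" and P: "separated_partition E (V - S) P" and cardP: "card (odd_parts P) = card S"
    using SP by (auto simp: barrier_def)
  have finS: "finite S" using SV finV finite_subset by blast
  note PU = separated_partitionD(1)[OF P] and Pne = separated_partitionD(2)[OF P]
    and Pdis = separated_partitionD(3)[OF P] and Psep = separated_partitionD(4)[OF P]
  have finP: "finite P" using P finV by (meson finite_Diff finite_elements separated_partition_def)
  have finC: "finite C" if "C \<in> P" for C
    using that PU finV by (metis Sup_upper finite_Diff finite_subset)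

  \<comment> \<open>By maximality of \<open>S\<close>, enlarging it inside a part never attains equality in Tutte's condition.\<close>
  have refine: "card (odd_parts (P - {C})) + card (odd_parts P') < card (S \<union> S')"
    if C: "C \<in> P" and S': "S' \<subseteq> C" "S' \<noteq> {}" and P': "separated_partition E (C - S') P'" for C S' P'
  proof -
    have CV: "C \<subseteq> V - S" using C PU by blast
    note P'U = separated_partitionD(1)[OF P'] and P'ne = separated_partitionD(2)[OF P']
      and P'dis = separated_partitionD(3)[OF P'] and P'sep = separated_partitionD(4)[OF P']
    have finP': "finite P'" using P'U finC[OF C] by (metis finite_Diff finite_UnionD)
    have P'C: "D \<subseteq> C" if "D \<in> P'" for D using that P'U by blast
    define Q where "Q = (P - {C}) \<union> P'"
    have Q: "separated_partition E (V - (S \<union> S')) Q"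
    proof (rule separated_partitionI)
      have rest: "\<Union>(P - {C}) = V - S - C"
      proof -
        have "x \<notin> C" if "x \<in> D" "D \<in> P - {C}" for x D using Pdis[of D C] C that by blast
        then have "\<Union>(P - {C}) = \<Union>P - C" by blast
        then show ?thesis using PU by simp
      qed
      show "\<Union>Q = V - (S \<union> S')"
        unfolding Q_def Union_Un_distrib rest P'U using CV S' by blast
      show "{} \<notin> Q" using Pne P'ne by (simp add: Q_def)
      fix D D' assume D: "D \<in> Q" "D' \<in> Q" "D \<noteq> D'"
      consider "D \<in> P - {C}" "D' \<in> P - {C}" | "D \<in> P - {C}" "D' \<in> P'" | "D \<in> P'" "D' \<in> P - {C}"
        | "D \<in> P'" "D' \<in> P'" using D by (auto simp: Q_def)
      note cases = this
      show "D \<inter> D' = {}"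
      proof (cases rule: cases)
        case 2
        then show ?thesis using Pdis[of D C] P'C[of D'] C by blast
      next
        case 3
        then show ?thesis using Pdis[of D' C] P'C[of D] C by blast
      next
        case 1
        then show ?thesis using Pdis[of D D'] D(3) by simp
      next
        case 4
        then show ?thesis using P'dis[of D D'] D(3) by simp
      qed
      fix x y assume xy: "x \<in> D" "y \<in> D'"
      show "\<not> E x y"
      proof (cases rule: cases)
        case 2
        then show ?thesis using Psep[of D C] P'C[of D'] C xy by blast
      next
        case 3
        then show ?thesis using Psep[of C D'] P'C[of D] C xy by blast
      next
        case 1
        then show ?thesis using Psep[of D D' x y] D(3) xy by simp
      next
        case 4
        then show ?thesis using P'sep[of D D' x y] D(3) xy by simp
      qed
    qed
    have "card (odd_parts Q) = card (odd_parts (P - {C})) + card (odd_parts P')"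
    proof -
      have "D \<notin> P'" if "D \<in> P - {C}" for D
      proof
        assume "D \<in> P'"
        moreover have "D \<inter> C = {}" using that C Pdis by blast
        ultimately have "D = {}" using P'C by blast
        then show False using that Pne by simp
      qed
      then have "odd_parts (P - {C}) \<inter> odd_parts P' = {}" by (auto simp: odd_parts_def)
      moreover have "odd_parts Q = odd_parts (P - {C}) \<union> odd_parts P'"
        by (auto simp: odd_parts_def Q_def)
      ultimately show ?thesis using finP finP'
        by (simp add: card_Un_disjoint odd_parts_def)
    qed
    moreover have "S \<union> S' \<subseteq> V" using SV S' CV by blast
    moreover have "card (odd_parts Q) \<noteq> card (S \<union> S')"
    proof
      assume "card (odd_parts Q) = card (S \<union> S')"
      then have "barrier (S \<union> S') Q" using Q \<open>S \<union> S' \<subseteq> V\<close> by (simp add: barrier_def)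
      then have "card (S \<union> S') \<le> card S" by (rule max)
      moreover have "S \<subset> S \<union> S'" using S' CV by blast
      then have "card S < card (S \<union> S')"
        using \<open>S \<union> S' \<subseteq> V\<close> finV by (meson finite_subset psubset_card_mono)
      ultimately show False by simp
    qed
    ultimately show ?thesis using tutte[of "S \<union> S'" Q] Q by simp
  qed

  \<comment> \<open>Moving a vertex \<open>v\<close> of an even part into \<open>S\<close> would
    make \<open>C - {v}\<close> a new odd part, so both sides would grow by one, against
    \<open>refine\<close>.\<close>
  have odd: "odd (card C)" if C: "C \<in> P" for C
  proof (rule ccontr)
    assume even: "\<not> odd (card C)"
    obtain v where v: "v \<in> C" using C Pne by fastforce
    have oddv: "odd (card (C - {v}))"
      using even card_Suc_Diff1[OF finC[OF C] v] by (metis even_Suc)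
    then have "C - {v} \<noteq> {}" by (metis card.empty even_zero)
    then have "separated_partition E (C - {v}) {C - {v}}"
      by (auto simp: separated_partition_def intro: partition_on_space)
    from refine[OF C _ _ this] v
    have "card (odd_parts (P - {C})) + card (odd_parts {C - {v}}) < card (S \<union> {v})" by simp
    moreover have "odd_parts (P - {C}) = odd_parts P" using even by (auto simp: odd_parts_def)
    moreover have "odd_parts {C - {v}} = {C - {v}}" using oddv by (auto simp: odd_parts_def)
    moreover have "card (S \<union> {v}) \<le> Suc (card S)" by (simp add: card_insert_le_m1 finS card_insert_if)
    ultimately show False using cardP by simp
  qed
  then have oddP: "odd_parts P = P" by (auto simp: odd_parts_def)

  \<comment> \<open>Parts are factor-critical: by parity a violation inside \<open>C - {v}\<close>
    has excess at least two, which pays for adding \<open>v\<close> to the barrier and for losing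
    the odd part \<open>C\<close>, against \<open>refine\<close>.\<close>
  have critical: "\<exists>M. perfect_matching_on E (C - {v}) M" if C: "C \<in> P" and v: "v \<in> C" for C v
  proof (rule less.hyps)
    have CV: "C \<subseteq> V - S" using C PU by blast
    then have "C - {v} \<subset> V" using v by blast
    then show "card (C - {v}) < card V" using finV by (rule psubset_card_mono[rotated])
    show "finite (C - {v})" using finC[OF C] by simp
    show "symp E" by (fact sym)
    fix S' P' assume S': "S' \<subseteq> C - {v}" and P': "separated_partition E (C - {v} - S') P'"
    have fin': "finite S'" using S' finC[OF C] finite_subset by blast
    show "card (odd_parts P') \<le> card S'"
    proof (rule ccontr)
      assume less: "\<not> card (odd_parts P') \<le> card S'"
      have "even (card (odd_parts P')) \<longleftrightarrow> even (card (C - {v} - S'))"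
        using P' finC[OF C] by (intro even_card_odd_parts_iff) (auto simp: separated_partition_def)
      also have "card (C - {v} - S') = card (C - {v}) - card S'"
        using S' fin' by (simp add: card_Diff_subset)
      also have "even \<dots> \<longleftrightarrow> even (card S')"
      proof -
        have "even (card (C - {v}))" using odd[OF C] v finC[OF C] by simp
        moreover have "card S' \<le> card (C - {v})" using S' finC[OF C] by (simp add: card_mono)
        ultimately show ?thesis by (metis dvd_diff_nat dvd_diffD1)
      qed
      finally have ge: "card S' + 2 \<le> card (odd_parts P')" using less by presburger
      have "C - insert v S' = C - {v} - S'" by blast
      with P' refine[OF C, of "insert v S'" P'] S' v
      have "card (odd_parts (P - {C})) + card (odd_parts P') < card (S \<union> insert v S')" by auto
      moreover have "card (S \<union> insert v S') \<le> card S + Suc (card S')"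
        using card_Un_le[of S "insert v S'"] fin' by (simp add: card_insert_if split: if_splits)
      moreover have "odd_parts (P - {C}) = odd_parts P - {C}" by (auto simp: odd_parts_def)
      then have "card (odd_parts (P - {C})) + 1 = card S"
        using cardP finP C oddP card_Suc_Diff1[of P C] by simp
      ultimately show False using ge by simp
    qed
  qed

  define N where "N C = {s \<in> S. \<exists>v\<in>C. E v s}" for C
  \<comment> \<open>Each part is assigned its own neighbour in \<open>S\<close>. If a family
    \<open>F\<close> of parts had too few neighbours, deleting only these would already violate
    Tutte's condition.\<close>
  have "\<exists>f. inj_on f P \<and> (\<forall>C\<in>P. f C \<in> N C)"
  proof (rule hall_marriage)
    show "finite P" by (fact finP)
    show "finite (N C)" for C using finS by (simp add: N_def)
    fix F assume F: "F \<subseteq> P"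
    define S' where "S' = \<Union>(N ` F)"
    \<comment> \<open>All remaining vertices are lumped into one part, which \<open>Q\<close> omits
      when it is empty; only the parts in \<open>F\<close> are counted.\<close>
    define R where "R = V - S' - \<Union>F"
    have S'S: "S' \<subseteq> S" by (auto simp: S'_def N_def)
    have FV: "\<Union>F \<subseteq> V - S" using F PU by blast
    have sep: "\<not> E x y" if "C \<in> F" "x \<in> C" "y \<in> V - S'" "y \<notin> C" for C x y
    proof (cases "y \<in> S")
      case True
      then show ?thesis using that by (auto simp: S'_def N_def)
    next
      case False
      then have "y \<in> \<Union>P" using that(3) PU by simp
      then obtain D where D: "D \<in> P" "y \<in> D" by (rule UnionE)
      moreover have "C \<in> P" "C \<noteq> D" using that F D by auto
      ultimately show ?thesis using Psep[of C D x y] that(2) by simp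
    qed
    define Q where "Q = F \<union> ({R} - {{}})"
    have Q: "separated_partition E (V - S') Q"
    proof (rule separated_partitionI)
      have "\<Union>Q = \<Union>F \<union> R" by (auto simp: Q_def)
      then show "\<Union>Q = V - S'" using FV S'S by (auto simp: R_def)
      show "{} \<notin> Q" using Pne F by (auto simp: Q_def)
      fix C D assume CD: "C \<in> Q" "D \<in> Q" "C \<noteq> D"
      then show dis: "C \<inter> D = {}"
        using Pdis[of C D] F by (auto simp: Q_def R_def)
      fix x y assume xy: "x \<in> C" "y \<in> D"
      have "C \<subseteq> V - S'" "D \<subseteq> V - S'" using CD \<open>\<Union>Q = V - S'\<close> by blast+
      moreover have "C \<in> F \<or> D \<in> F" using CD by (auto simp: Q_def)
      ultimately show "\<not> E x y"
        using sep[of C x y] sep[of D y x] sympD[OF sym, of x y] xy dis by blast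
    qed
    have "F \<subseteq> odd_parts Q" using F odd by (auto simp: odd_parts_def Q_def)
    moreover have "finite (odd_parts Q)"
      using finite_subset[OF F finP] by (simp add: odd_parts_def Q_def)
    ultimately have "card F \<le> card (odd_parts Q)" by (rule card_mono[rotated])
    also have "\<dots> \<le> card S'" using Q S'S SV by (intro tutte) auto
    finally show "card F \<le> card (\<Union>(N ` F))" by (simp add: S'_def)
  qed
  then obtain f where f: "inj_on f P" "\<And>C. C \<in> P \<Longrightarrow> f C \<in> N C" by blast
  \<comment> \<open>There are as many parts as elements of \<open>S\<close>, so the injection uses
    up all of \<open>S\<close>.\<close>
  have fS: "f ` P = S"
  proof (rule card_subset_eq[OF finS])
    show "f ` P \<subseteq> S" using f(2) by (auto simp: N_def)
    show "card (f ` P) = card S" using f(1) cardP oddP by (simp add: card_image)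
  qed
  have "\<forall>C\<in>P. \<exists>v\<in>C. E v (f C)" using f(2) by (auto simp: N_def)
  then obtain w where w: "\<And>C. C \<in> P \<Longrightarrow> w C \<in> C \<and> E (w C) (f C)" by metis
  have "\<forall>C\<in>P. \<exists>M. perfect_matching_on E (C - {w C}) M" using critical w by blast
  then obtain M where M: "\<And>C. C \<in> P \<Longrightarrow> perfect_matching_on E (C - {w C}) (M C)" by metis
  have fnotin: "f C \<notin> D" if "C \<in> P" "D \<in> P" for C D
  proof -
    have "f C \<in> S" using that fS by blast
    then have "f C \<notin> \<Union>P" using PU by simp
    then show ?thesis using that by blast
  qed
  \<comment> \<open>In each part, \<open>w C\<close> is matched to \<open>f C\<close> and the rest
    of the part by criticality.\<close>
  have "perfect_matching_on E (\<Union>C\<in>P. insert (f C) C) (\<Union>C\<in>P. insert {w C, f C} (M C))"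
  proof (rule perfect_matching_on_UN)
    fix C assume C: "C \<in> P"
    have "perfect_matching_on E (insert (w C) (insert (f C) (C - {w C}))) (insert {w C, f C} (M C))"
      using M[OF C] w[OF C] fnotin[OF C C] by (intro perfect_matching_on_insert) auto
    moreover have "insert (w C) (insert (f C) (C - {w C})) = insert (f C) C" using w[OF C] by blast
    ultimately show "perfect_matching_on E (insert (f C) C) (insert {w C, f C} (M C))" by simp
  next
    fix C D assume CD: "C \<in> P" "D \<in> P" "C \<noteq> D"
    then have "f C \<noteq> f D" using f(1) by (auto dest: inj_onD)
    then show "insert (f C) C \<inter> insert (f D) D = {}"
      using CD Pdis[of C D] fnotin by auto
  qed
  moreover have "(\<Union>C\<in>P. insert (f C) C) = V"
  proof -
    have "(\<Union>C\<in>P. insert (f C) C) = f ` P \<union> \<Union>P" by blast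
    then show ?thesis using fS PU SV by auto
  qed
  ultimately show ?case by metis
qed

text \<open>From a violation of Tutte's condition, \<open>card S + 1\<close> odd parts are kept and
  all others are merged into one set \<open>R\<close>. Since \<open>card V\<close> is even,
  \<open>R\<close> is odd, hence nonempty, and is the last part.\<close>

lemma odd_separated_partition_if_no_perfect_matching:
  fixes E :: "'a \<Rightarrow> 'a \<Rightarrow> bool"
  assumes "finite V" "even (card V)" "symp E" "\<nexists>M. perfect_matching_on E V M"
  obtains S P where "S \<subseteq> V" "separated_partition E (V - S) P" "card P = card S + 2"
    "\<And>C. C \<in> P \<Longrightarrow> odd (card C)"
proof -
  obtain S P where S: "S \<subseteq> V" and P: "separated_partition E (V - S) P"
    and gt: "card S < card (odd_parts P)"
    using tutte[OF assms(1,3)] assms(4) not_le by blast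
  have finT: "finite (V - S)" using assms(1) by simp
  have cardT: "card (V - S) + card S = card V"
    using S assms(1) by (metis card_Diff_subset card_mono finite_subset le_add_diff_inverse2)
  have "even (card (odd_parts P)) \<longleftrightarrow> even (card (V - S))"
    using P finT by (intro even_card_odd_parts_iff) (auto simp: separated_partition_def)
  then have "Suc (card S) \<le> card (odd_parts P)" using gt by simp
  then obtain F where F: "F \<subseteq> odd_parts P" "card F = Suc (card S)" "finite F"
    using obtain_subset_with_card_n by metis
  have FP: "F \<subseteq> P" and Fodd: "\<And>C. C \<in> F \<Longrightarrow> odd (card C)" using F(1) by (auto simp: odd_parts_def)
  note PU = separated_partitionD(1)[OF P] and Pne = separated_partitionD(2)[OF P]
    and Pdis = separated_partitionD(3)[OF P] and Psep = separated_partitionD(4)[OF P]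
  define R where "R = \<Union>(P - F)"
  have disR: "C \<inter> R = {}" if "C \<in> F" for C
    using that Pdis FP by (fastforce simp: R_def)
  have U: "\<Union>F \<union> R = V - S" unfolding R_def PU[symmetric] using FP by blast
  have finC: "finite C" if "C \<in> F" for C using that U finT by (metis Sup_upper Un_upper1 finite_subset)
  have finR: "finite R" using U finT by (metis Un_upper2 finite_subset)
  have disF: "disjoint F" using FP Pdis by (auto simp: pairwise_def disjnt_def)
  have "card (V - S) = card (\<Union>F) + card R"
    unfolding U[symmetric] using disR F(3) finC finR by (intro card_Un_disjoint) auto
  also have "card (\<Union>F) = (\<Sum>C\<in>F. card C)" using disF finC by (intro card_Union_disjoint) auto
  finally have "card V = (\<Sum>C\<in>F. card C) + card R + card S" using cardT by simp
  moreover have "even (\<Sum>C\<in>F. card C) \<longleftrightarrow> odd (card S)"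
  proof -
    have "{C \<in> F. odd (card C)} = F" using Fodd by blast
    then show ?thesis using F(2,3) by (simp add: even_sum_iff)
  qed
  ultimately have oddR: "odd (card R)" using assms(2) by (metis even_add)
  then have Rne: "R \<noteq> {}" by (metis card.empty even_zero)
  have RF: "R \<notin> F" using disR Rne by blast
  have "separated_partition E (V - S) (insert R F)"
  proof (rule separated_partitionI)
    show "\<Union>(insert R F) = V - S" using U by blast
    show "{} \<notin> insert R F" using Rne Pne FP by blast
    fix C D assume CD: "C \<in> insert R F" "D \<in> insert R F" "C \<noteq> D"
    then consider "C \<in> F" "D \<in> F" | "C \<in> F" "D = R" | "C = R" "D \<in> F" by blast
    note cases = this
    show "C \<inter> D = {}"
      using cases by cases (use CD disR disF in \<open>auto simp: pairwise_def disjnt_def\<close>)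
    fix x y assume xy: "x \<in> C" "y \<in> D"
    show "\<not> E x y"
    proof (cases rule: cases)
      case 1
      then show ?thesis using Psep[of C D] FP CD xy by blast
    next
      case 2
      then obtain D' where "D' \<in> P - F" "y \<in> D'" using xy by (auto simp: R_def)
      then show ?thesis using Psep[of C D'] FP 2 xy by blast
    next
      case 3
      then obtain C' where "C' \<in> P - F" "x \<in> C'" using xy by (auto simp: R_def)
      then show ?thesis using Psep[of C' D] FP 3 xy by blast
    qed
  qed
  moreover have "card (insert R F) = card S + 2" using F RF by simp
  moreover have "\<And>C. C \<in> insert R F \<Longrightarrow> odd (card C)" using oddR Fodd by blast
  ultimately show ?thesis using that S by blast
qed

section \<open>Rayleigh quotients\<close>

text \<open>A crude bound by the absolute values of the entries suffices. It is applied both to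
  \<open>A\<close> and to an inverse matrix; the summand 1 in \<open>K\<close> makes division by
  \<open>K\<close> possible.\<close>

lemma quadratic_form_bounded:
  fixes A :: "real mat"
  assumes "A \<in> carrier_mat n n"
  obtains K where "K > 0" "\<And>x. x \<in> carrier_vec n \<Longrightarrow> x \<bullet> (A *\<^sub>v x) \<le> K * (x \<bullet> x)"
proof -
  define K where "K = 1 + (\<Sum>i<n. \<Sum>j<n. \<bar>A $$ (i, j)\<bar>)"
  have "x \<bullet> (A *\<^sub>v x) \<le> K * (x \<bullet> x)" if x: "x \<in> carrier_vec n" for x
  proof -
    have sq: "(x $ i)\<^sup>2 \<le> x \<bullet> x" if "i < n" for i
      using x that by (auto simp: scalar_prod_def power2_eq_square intro!: member_le_sum)
    have nonneg: "0 \<le> x \<bullet> x" using x by (simp add: scalar_prod_def sum_nonneg)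
    have "x \<bullet> (A *\<^sub>v x) = (\<Sum>i<n. \<Sum>j<n. x $ i * (A $$ (i, j) * x $ j))"
      using assms x by (simp add: scalar_prod_def sum_distrib_left lessThan_atLeast0)
    also have "\<dots> \<le> (\<Sum>i<n. \<Sum>j<n. \<bar>A $$ (i, j)\<bar> * (x \<bullet> x))"
    proof (intro sum_mono)
      fix i j assume "i \<in> {..<n}" "j \<in> {..<n}"
      then have "(x $ i)\<^sup>2 \<le> x \<bullet> x" "(x $ j)\<^sup>2 \<le> x \<bullet> x" using sq by auto
      moreover have "2 * \<bar>x $ i * x $ j\<bar> \<le> (x $ i)\<^sup>2 + (x $ j)\<^sup>2"
        using sum_squares_bound[of "\<bar>x $ i\<bar>" "\<bar>x $ j\<bar>"] by (simp add: abs_mult)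
      ultimately have "\<bar>x $ i * x $ j\<bar> \<le> x \<bullet> x" by linarith
      then have "\<bar>A $$ (i, j)\<bar> * \<bar>x $ i * x $ j\<bar> \<le> \<bar>A $$ (i, j)\<bar> * (x \<bullet> x)"
        by (intro mult_left_mono) auto
      moreover have "x $ i * (A $$ (i, j) * x $ j) \<le> \<bar>A $$ (i, j)\<bar> * \<bar>x $ i * x $ j\<bar>"
        by (metis abs_ge_self abs_mult mult.left_commute)
      ultimately show "x $ i * (A $$ (i, j) * x $ j) \<le> \<bar>A $$ (i, j)\<bar> * (x \<bullet> x)" by linarith
    qed
    also have "\<dots> \<le> K * (x \<bullet> x)"
      using nonneg by (simp add: K_def sum_distrib_right distrib_right)
    finally show ?thesis .
  qed
  moreover have "K > 0" unfolding K_def by (intro add_pos_nonneg sum_nonneg) auto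
  ultimately show ?thesis by (rule that[rotated])
qed

lemma scalar_prod_mult_mat_vec_commute:
  fixes A :: "real mat"
  assumes "A \<in> carrier_mat n n" "A\<^sup>T = A" "x \<in> carrier_vec n" "y \<in> carrier_vec n"
  shows "x \<bullet> (A *\<^sub>v y) = y \<bullet> (A *\<^sub>v x)"
proof -
  have "x \<bullet> (A *\<^sub>v y) = (A\<^sup>T *\<^sub>v x) \<bullet> y"
    using assms transpose_vec_mult_scalar[of A n n y x] by simp
  also have "\<dots> = y \<bullet> (A *\<^sub>v x)" using assms comm_scalar_prod[of "A *\<^sub>v x" n y] by simp
  finally show ?thesis .
qed

text \<open>The form at \<open>x + t y\<close> is a nonnegative quadratic polynomial in
  \<open>t\<close>; evaluating it at its minimum gives the inequality.\<close>

lemma psd_Cauchy_Schwarz: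
  fixes B :: "real mat"
  assumes B: "B \<in> carrier_mat n n" "B\<^sup>T = B"
    and psd: "\<And>x. x \<in> carrier_vec n \<Longrightarrow> 0 \<le> x \<bullet> (B *\<^sub>v x)"
    and xy: "x \<in> carrier_vec n" "y \<in> carrier_vec n"
  shows "(x \<bullet> (B *\<^sub>v y))\<^sup>2 \<le> (x \<bullet> (B *\<^sub>v x)) * (y \<bullet> (B *\<^sub>v y))"
proof -
  let ?a = "x \<bullet> (B *\<^sub>v x)" and ?b = "x \<bullet> (B *\<^sub>v y)" and ?c = "y \<bullet> (B *\<^sub>v y)"
  have quad: "0 \<le> ?a + 2 * t * ?b + t\<^sup>2 * ?c" for t
  proof -
    have "0 \<le> (x + t \<cdot>\<^sub>v y) \<bullet> (B *\<^sub>v (x + t \<cdot>\<^sub>v y))" using xy by (intro psd) auto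
    also have "B *\<^sub>v (x + t \<cdot>\<^sub>v y) = B *\<^sub>v x + t \<cdot>\<^sub>v (B *\<^sub>v y)"
      using B xy by (simp add: mult_add_distrib_mat_vec[of _ n n] mult_mat_vec[of _ n n])
    also have "(x + t \<cdot>\<^sub>v y) \<bullet> \<dots> = ?a + t * ?b + t * (y \<bullet> (B *\<^sub>v x)) + t\<^sup>2 * ?c"
      using B xy
      by (simp add: add_scalar_prod_distrib[of _ n] scalar_prod_add_distrib[of _ n] power2_eq_square algebra_simps)
    finally show ?thesis
      using scalar_prod_mult_mat_vec_commute[OF B xy] by simp
  qed
  show ?thesis
  proof (cases "?c = 0")
    case True
    have "?b = 0"
    proof (rule ccontr)
      assume "?b \<noteq> 0"
      \<comment> \<open>With \<open>?c = 0\<close> the polynomial is affine in \<open>t\<close>, and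
        this \<open>t\<close> gives it the value -1.\<close>
      then show False using quad[of "- (?a + 1) / (2 * ?b)"] True by (simp add: field_simps)
    qed
    then show ?thesis using True by simp
  next
    case False
    then have "?c > 0" using psd[OF xy(2)] by simp
    moreover have "0 \<le> ?a - ?b\<^sup>2 / ?c"
      using quad[of "- ?b / ?c"] \<open>?c > 0\<close> by (simp add: power2_eq_square field_simps)
    ultimately show ?thesis by (simp add: field_simps)
  qed
qed

text \<open>The supremum \<open>\<mu>\<close> of the Rayleigh quotients is an eigenvalue: otherwise \<open>\<mu> I - A\<close> is
  positive semidefinite and invertible, hence bounded below by a positive multiple of the identity.\<close>

theorem Max_spectrum_ge_Rayleigh:
  fixes A :: "real mat"
  assumes A: "A \<in> carrier_mat n n" and sym: "A\<^sup>T = A"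
    and x: "x \<in> carrier_vec n" "x \<noteq> 0\<^sub>v n" and le: "l * (x \<bullet> x) \<le> x \<bullet> (A *\<^sub>v x)"
  shows "l \<le> Max (spectrum A)"
proof -
  have pos: "y \<bullet> y > 0" if "y \<in> carrier_vec n" "y \<noteq> 0\<^sub>v n" for y :: "real vec"
  proof -
    have "y \<bullet> y \<noteq> 0" "y \<bullet> y \<ge> 0"
      using that conjugate_square_eq_0_vec[of y n] by (auto simp: scalar_prod_def sum_nonneg)
    then show ?thesis by simp
  qed
  define R where "R = {r. \<exists>y \<in> carrier_vec n. y \<noteq> 0\<^sub>v n \<and> r * (y \<bullet> y) = y \<bullet> (A *\<^sub>v y)}"
  obtain K where K: "\<And>y. y \<in> carrier_vec n \<Longrightarrow> y \<bullet> (A *\<^sub>v y) \<le> K * (y \<bullet> y)"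
    using quadratic_form_bounded[OF A] by blast
  have bdd: "bdd_above R"
  proof (rule bdd_aboveI)
    fix r assume "r \<in> R"
    then obtain y where y: "y \<in> carrier_vec n" "y \<noteq> 0\<^sub>v n" "r * (y \<bullet> y) = y \<bullet> (A *\<^sub>v y)"
      by (auto simp: R_def)
    then have "r * (y \<bullet> y) \<le> K * (y \<bullet> y)" using K by simp
    then show "r \<le> K" using pos[OF y(1,2)] by simp
  qed
  have inR: "(y \<bullet> (A *\<^sub>v y)) / (y \<bullet> y) \<in> R" if "y \<in> carrier_vec n" "y \<noteq> 0\<^sub>v n" for y
    using that pos[OF that] by (auto simp: R_def intro!: bexI[of _ y])
  define \<mu> where "\<mu> = Sup R"
  have Rne: "R \<noteq> {}" using inR[OF x] by blast
  have mu: "y \<bullet> (A *\<^sub>v y) \<le> \<mu> * (y \<bullet> y)" if y: "y \<in> carrier_vec n" for y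
  proof (cases "y = 0\<^sub>v n")
    case False
    have "(y \<bullet> (A *\<^sub>v y)) / (y \<bullet> y) \<le> \<mu>"
      unfolding \<mu>_def using inR[OF y False] bdd by (rule cSup_upper)
    then show ?thesis using pos[OF y False] by (simp add: field_simps)
  qed (use A in simp)
  define B where "B = \<mu> \<cdot>\<^sub>m 1\<^sub>m n - A"
  have B: "B \<in> carrier_mat n n" using A unfolding B_def by (rule minus_carrier_mat)
  have Bv: "B *\<^sub>v y = \<mu> \<cdot>\<^sub>v y - A *\<^sub>v y" if "y \<in> carrier_vec n" for y
  proof -
    have "(\<mu> \<cdot>\<^sub>m 1\<^sub>m n) *\<^sub>v y = \<mu> \<cdot>\<^sub>v (1\<^sub>m n *\<^sub>v y)"
      using that by (intro eq_vecI) (auto simp: smult_scalar_prod_distrib[of _ n])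
    then show ?thesis
      unfolding B_def using A that by (subst minus_mult_distrib_mat_vec[of _ n n]) auto
  qed
  have Bq: "y \<bullet> (B *\<^sub>v y) = \<mu> * (y \<bullet> y) - y \<bullet> (A *\<^sub>v y)" if y: "y \<in> carrier_vec n" for y
    unfolding Bv[OF y] using A y by (simp add: scalar_prod_minus_distrib[of _ n])
  have "eigenvalue A \<mu>"
  proof (rule ccontr)
    assume noev: "\<not> eigenvalue A \<mu>"
    have "det B \<noteq> 0"
    proof
      assume "det B = 0"
      then obtain v where v: "v \<in> carrier_vec n" "v \<noteq> 0\<^sub>v n" "B *\<^sub>v v = 0\<^sub>v n"
        using det_0_iff_vec_prod_zero_field[OF B] by blast
      have "A *\<^sub>v v = \<mu> \<cdot>\<^sub>v v"
      proof (rule eq_vecI)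
        fix i assume "i < dim_vec (\<mu> \<cdot>\<^sub>v v)"
        then have i: "i < n" using v by simp
        then have "(\<mu> \<cdot>\<^sub>v v - A *\<^sub>v v) $ i = 0" using v Bv[of v] by simp
        then show "(A *\<^sub>v v) $ i = (\<mu> \<cdot>\<^sub>v v) $ i" using i A v by simp
      qed (use A v in simp)
      then have "eigenvalue A \<mu>" using v A unfolding eigenvalue_def eigenvector_def by auto
      with noev show False ..
    qed
    then obtain C where C: "C \<in> carrier_mat n n" "B * C = 1\<^sub>m n"
      using det_non_zero_imp_unit[OF B, of "()"] by (auto simp: Units_def ring_mat_def)
    obtain K where K: "K > 0" "\<And>y. y \<in> carrier_vec n \<Longrightarrow> y \<bullet> (C *\<^sub>v y) \<le> K * (y \<bullet> y)"
      using quadratic_form_bounded[OF C(1)] by blast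
    have symB: "B\<^sup>T = B"
    proof (rule eq_matI)
      fix i j assume ij: "i < dim_row B" "j < dim_col B"
      have "A $$ (j, i) = A\<^sup>T $$ (i, j)" using ij A B by simp
      then show "B\<^sup>T $$ (i, j) = B $$ (i, j)" using ij A B sym by (auto simp: B_def)
    qed (use B in auto)
    \<comment> \<open>With \<open>z\<close> the preimage of \<open>y\<close> under \<open>B\<close>,
      Cauchy-Schwarz for the form of \<open>B\<close> bounds \<open>(y \<bullet> y)\<^sup>2\<close>
      by the form of \<open>B\<close> at \<open>y\<close> times the form of the inverse
      \<open>C\<close> at \<open>y\<close>, and the latter is at most
      \<open>K * (y \<bullet> y)\<close>.\<close>
    have gap: "y \<bullet> y / K \<le> y \<bullet> (B *\<^sub>v y)" if y: "y \<in> carrier_vec n" for y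
    proof (cases "y = 0\<^sub>v n")
      case False
      define z where "z = C *\<^sub>v y"
      have z: "z \<in> carrier_vec n" using C y by (simp add: z_def)
      have "B *\<^sub>v z = y"
        using B C y by (simp add: z_def assoc_mult_mat_vec[of _ n n _ n, symmetric])
      then have "(y \<bullet> y)\<^sup>2 = (y \<bullet> (B *\<^sub>v z))\<^sup>2" by simp
      also have "\<dots> \<le> (y \<bullet> (B *\<^sub>v y)) * (z \<bullet> (B *\<^sub>v z))"
        using B symB y z mu by (intro psd_Cauchy_Schwarz[of _ n]) (auto simp: Bq)
      also have "z \<bullet> (B *\<^sub>v z) = y \<bullet> (C *\<^sub>v y)"
        using \<open>B *\<^sub>v z = y\<close> comm_scalar_prod[OF z y] by (simp add: z_def)
      also have "(y \<bullet> (B *\<^sub>v y)) * (y \<bullet> (C *\<^sub>v y)) \<le> (y \<bullet> (B *\<^sub>v y)) * (K * (y \<bullet> y))"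
        using K(2)[OF y] mu[OF y] by (intro mult_left_mono) (simp_all add: Bq[OF y])
      finally have "(y \<bullet> y) * (y \<bullet> y) \<le> (K * (y \<bullet> (B *\<^sub>v y))) * (y \<bullet> y)"
        by (simp add: power2_eq_square algebra_simps)
      then have "y \<bullet> y \<le> K * (y \<bullet> (B *\<^sub>v y))" using pos[OF y False] by simp
      then show ?thesis using K(1) by (simp add: field_simps)
    qed (use B in simp)
    \<comment> \<open>The gap pushes every Rayleigh quotient below the supremum by
      \<open>1 / K\<close>.\<close>
    have "\<mu> \<le> \<mu> - 1 / K"
      unfolding \<mu>_def
    proof (rule cSup_least[OF Rne])
      fix r assume "r \<in> R"
      then obtain y where y: "y \<in> carrier_vec n" "y \<noteq> 0\<^sub>v n" "r * (y \<bullet> y) = y \<bullet> (A *\<^sub>v y)"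
        by (auto simp: R_def)
      have "r * (y \<bullet> y) \<le> (\<mu> - 1 / K) * (y \<bullet> y)"
        using gap[OF y(1)] y(3) Bq[OF y(1)] by (simp add: algebra_simps)
      then show "r \<le> Sup R - 1 / K" using pos[OF y(1,2)] by (simp add: \<mu>_def)
    qed
    then show False using K(1) by simp
  qed
  then have "\<mu> \<le> Max (spectrum A)"
    using card_finite_spectrum(1)[OF A] by (intro Max_ge) (auto simp: spectrum_def)
  moreover have "l * (x \<bullet> x) \<le> \<mu> * (x \<bullet> x)" using le mu[OF x(1)] by simp
  then have "l \<le> \<mu>" using pos[OF x] by simp
  ultimately show ?thesis by simp
qed

section \<open>The distance signless Laplacian\<close>

lemma (in pair_graph) gdist_commute: "gdist G u v = gdist G v u"
proof -
  have len: "length (rev_path p) = length p" for p :: "('a \<times> 'a) list"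
    by (induction p) auto
  have "(\<exists>p. apath u p v \<and> length p = k) \<longleftrightarrow> (\<exists>p. apath v p u \<and> length p = k)" for k
    by (metis apath_rev_path len)
  then show ?thesis by (simp add: gdist_def)
qed

text \<open>Connectedness makes the minimum in \<open>gdist\<close> an attained one, so the bounds
  can be read off a shortest path: it is not empty, and a path of length one is the arc
  \<open>(u, v)\<close>.\<close>

lemma (in pair_graph) gdist_ge:
  assumes "Digraph_Component.connected (with_proj G)" "u \<in> pverts G" "v \<in> pverts G" "u \<noteq> v"
  shows "1 \<le> gdist G u v" and "(u, v) \<notin> parcs G \<Longrightarrow> 2 \<le> gdist G u v"
proof -
  have "u \<rightarrow>\<^sup>*\<^bsub>with_proj G\<^esub> v"
    using symmetric_connected_imp_strongly_connected[OF sym_arcs assms(1)] assms(2,3)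
    by (simp add: strongly_connected_def)
  then obtain p0 where "apath u p0 v"
    using reachable_apath by blast
  then have "\<exists>p. apath u p v \<and> length p = gdist G u v"
    using LeastI_ex[of "\<lambda>k. \<exists>p. apath u p v \<and> length p = k"] by (auto simp: gdist_def)
  then obtain p where p: "apath u p v" "length p = gdist G u v" by blast
  have "p \<noteq> []" using p assms(4) by (auto simp: apath_Nil_iff)
  then show "1 \<le> gdist G u v" using p(2) by (cases p) auto
  assume non: "(u, v) \<notin> parcs G"
  show "2 \<le> gdist G u v"
  proof (rule ccontr)
    assume "\<not> ?thesis"
    then have "length p = Suc 0" using p(2) \<open>1 \<le> gdist G u v\<close> by simp
    then obtain e where "p = [e]" by (auto simp: length_Suc_conv)
    then show False using p(1) non by (auto simp: apath_Cons_iff apath_Nil_iff)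
  qed
qed

text \<open>Used to exclude \<open>S = {}\<close>, where two parts without edges between them would
  cover the graph.\<close>

lemma (in pair_graph) connected_imp_closed_eq_pverts:
  assumes "Digraph_Component.connected (with_proj G)" "C \<subseteq> pverts G" "C \<noteq> {}"
    and closed: "\<And>u v. (u, v) \<in> parcs G \<Longrightarrow> u \<in> C \<Longrightarrow> v \<in> C"
  shows "C = pverts G"
proof -
  obtain u where u: "u \<in> C" using assms(3) by blast
  have walk: "v \<in> C" if "awalk u p v" "u \<in> C" for u p v
    using that by (induction p arbitrary: u) (auto simp: awalk_Cons_iff awalk_Nil_iff closed)
  have "v \<in> C" if "v \<in> pverts G" for v
  proof -
    have "u \<rightarrow>\<^sup>*\<^bsub>with_proj G\<^esub> v"
      using symmetric_connected_imp_strongly_connected[OF sym_arcs assms(1)] assms(2) u that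
      by (auto simp: strongly_connected_def)
    then obtain p where "awalk u p v" using reachable_awalk by blast
    then show ?thesis using walk u by blast
  qed
  then show ?thesis using assms(2) by blast
qed

lemma sum_nth_distinct:
  assumes "distinct vs"
  shows "(\<Sum>i<length vs. f (vs ! i)) = (\<Sum>v\<in>set vs. f v)"
  using bij_betw_nth[OF assms refl refl] by (rule sum.reindex_bij_betw)

lemma distance_signless_laplacian_carrier:
  "distance_signless_laplacian G vs \<in> carrier_mat (length vs) (length vs)"
  by (simp add: distance_signless_laplacian_def transmission_matrix_def distance_matrix_def)

lemma (in pair_graph) distance_signless_laplacian_symmetric:
  "(distance_signless_laplacian G vs)\<^sup>T = distance_signless_laplacian G vs"
  by (rule eq_matI)
     (auto simp: distance_signless_laplacian_def transmission_matrix_def distance_matrix_def gdist_commute)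

text \<open>Expanding the transmissions gives a sum over ordered pairs. Adding its copy with
  \<open>u\<close> and \<open>v\<close> exchanged completes the squares, whence the division by
  2.\<close>

lemma (in pair_graph) distance_signless_laplacian_form:
  assumes "distinct vs" "set vs = pverts G"
  shows "vec (length vs) (\<lambda>i. x (vs ! i)) \<bullet>
      (distance_signless_laplacian G vs *\<^sub>v vec (length vs) (\<lambda>i. x (vs ! i))) =
    (\<Sum>u\<in>pverts G. \<Sum>v\<in>pverts G. real (gdist G u v) * (x u + x v)\<^sup>2) / 2"
    (is "?y \<bullet> (?Q *\<^sub>v ?y) = ?R / 2")
proof -
  let ?n = "length vs" and ?V = "pverts G" and ?d = "\<lambda>u v. real (gdist G u v)"
  have row: "(\<Sum>j<?n. ?Q $$ (i, j) * x (vs ! j)) =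
      real (transmission G (vs ! i)) * x (vs ! i) + (\<Sum>v\<in>?V. ?d (vs ! i) v * x v)"
    if i: "i < ?n" for i
  proof -
    have "(\<Sum>j<?n. ?Q $$ (i, j) * x (vs ! j)) =
        (\<Sum>j<?n. (if i = j then real (transmission G (vs ! i)) * x (vs ! i) else 0) +
          ?d (vs ! i) (vs ! j) * x (vs ! j))"
      using i by (intro sum.cong)
        (auto simp: distance_signless_laplacian_def transmission_matrix_def distance_matrix_def algebra_simps)
    also have "\<dots> = real (transmission G (vs ! i)) * x (vs ! i) +
        (\<Sum>j<?n. ?d (vs ! i) (vs ! j) * x (vs ! j))"
      using i by (simp add: sum.distrib)
    finally show ?thesis
      using sum_nth_distinct[OF assms(1), of "\<lambda>v. ?d (vs ! i) v * x v"] assms(2) by simp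
  qed
  have "?y \<bullet> (?Q *\<^sub>v ?y) = (\<Sum>i<?n. x (vs ! i) * (\<Sum>j<?n. ?Q $$ (i, j) * x (vs ! j)))"
    using distance_signless_laplacian_carrier[of G vs]
    by (simp add: scalar_prod_def lessThan_atLeast0)
  also have "\<dots> = (\<Sum>i<?n. x (vs ! i) *
      (real (transmission G (vs ! i)) * x (vs ! i) + (\<Sum>v\<in>?V. ?d (vs ! i) v * x v)))"
    using row by simp
  also have "\<dots> = (\<Sum>u\<in>?V. x u * (real (transmission G u) * x u + (\<Sum>v\<in>?V. ?d u v * x v)))"
    using sum_nth_distinct[OF assms(1),
        of "\<lambda>u. x u * (real (transmission G u) * x u + (\<Sum>v\<in>?V. ?d u v * x v))"] assms(2)
    by simp
  also have "\<dots> = (\<Sum>u\<in>?V. \<Sum>v\<in>?V. ?d u v * (x u)\<^sup>2 + ?d u v * (x u * x v))"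
    by (simp add: transmission_def sum.distrib sum_distrib_left sum_distrib_right power2_eq_square algebra_simps)
  finally have 1: "?y \<bullet> (?Q *\<^sub>v ?y) = (\<Sum>u\<in>?V. \<Sum>v\<in>?V. ?d u v * (x u)\<^sup>2 + ?d u v * (x u * x v))" .
  also have "\<dots> = (\<Sum>v\<in>?V. \<Sum>u\<in>?V. ?d u v * (x u)\<^sup>2 + ?d u v * (x u * x v))" by (rule sum.swap)
  also have "\<dots> = (\<Sum>u\<in>?V. \<Sum>v\<in>?V. ?d u v * (x v)\<^sup>2 + ?d u v * (x u * x v))"
    by (simp add: gdist_commute mult.commute)
  finally have 2: "?y \<bullet> (?Q *\<^sub>v ?y) = (\<Sum>u\<in>?V. \<Sum>v\<in>?V. ?d u v * (x v)\<^sup>2 + ?d u v * (x u * x v))" .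
  have "?R = (\<Sum>u\<in>?V. \<Sum>v\<in>?V. ?d u v * (x u)\<^sup>2 + ?d u v * (x u * x v)) +
      (\<Sum>u\<in>?V. \<Sum>v\<in>?V. ?d u v * (x v)\<^sup>2 + ?d u v * (x u * x v))"
    unfolding sum.distrib[symmetric] by (intro sum.cong) (auto simp: power2_eq_square algebra_simps)
  then show ?thesis using 1 2 by simp
qed

section \<open>Test vectors on separated partitions\<close>

lemma sum_sum_add_square:
  fixes x :: "'a \<Rightarrow> real"
  shows "(\<Sum>u\<in>A. \<Sum>v\<in>A. (x u + x v)\<^sup>2) = 2 * (real (card A) * (\<Sum>u\<in>A. (x u)\<^sup>2) + (\<Sum>u\<in>A. x u)\<^sup>2)"
proof -
  have "(\<Sum>u\<in>A. \<Sum>v\<in>A. (x u + x v)\<^sup>2) =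
      (\<Sum>u\<in>A. \<Sum>v\<in>A. (x u)\<^sup>2) + (\<Sum>u\<in>A. \<Sum>v\<in>A. (x v)\<^sup>2) + 2 * (\<Sum>u\<in>A. \<Sum>v\<in>A. x u * x v)"
    by (simp add: power2_sum sum.distrib sum_distrib_left mult.assoc)
  also have "(\<Sum>u\<in>A. \<Sum>v\<in>A. x u * x v) = (\<Sum>u\<in>A. x u)\<^sup>2"
    by (simp add: power2_eq_square sum_product)
  finally show ?thesis by (simp add: sum_distrib_left[symmetric])
qed

lemma sum_sum_restrict:
  fixes h :: "'a \<Rightarrow> 'a \<Rightarrow> real"
  assumes "finite V" "A \<subseteq> V"
  shows "(\<Sum>u\<in>V. \<Sum>v\<in>V. of_bool (u \<in> A \<and> v \<in> A) * h u v) = (\<Sum>u\<in>A. \<Sum>v\<in>A. h u v)"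
proof -
  have "(\<Sum>u\<in>V. \<Sum>v\<in>V. of_bool (u \<in> A \<and> v \<in> A) * h u v) =
      (\<Sum>u\<in>V. if u \<in> A then (\<Sum>v\<in>V. if v \<in> A then h u v else 0) else 0)"
    by (intro sum.cong) (auto intro!: sum.cong)
  then show ?thesis
    using assms by (simp add: sum.inter_restrict[symmetric] Int_absorb1)
qed

text \<open>The lower bound on \<open>d\<close> is a combination of indicators of squares:
  \<open>V \<times> V\<close> without its diagonal, plus \<open>T \<times> T\<close> without the
  squares \<open>C \<times> C\<close> of the parts. A square over \<open>A\<close> contributes
  \<open>2 * F A\<close> to the double sum.\<close>

lemma partitioned_form_ge:
  fixes d :: "'a \<Rightarrow> 'a \<Rightarrow> real" and x :: "'a \<Rightarrow> real"
  assumes fin: "finite V" and P: "partition_on T P" and T: "T \<subseteq> V"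
    and d0: "\<And>u v. 0 \<le> d u v" and d1: "\<And>u v. u \<in> V \<Longrightarrow> v \<in> V \<Longrightarrow> u \<noteq> v \<Longrightarrow> 1 \<le> d u v"
    and d2: "\<And>C D u v. C \<in> P \<Longrightarrow> D \<in> P \<Longrightarrow> C \<noteq> D \<Longrightarrow> u \<in> C \<Longrightarrow> v \<in> D \<Longrightarrow> 2 \<le> d u v"
  defines "F \<equiv> \<lambda>A. real (card A) * (\<Sum>u\<in>A. (x u)\<^sup>2) + (\<Sum>u\<in>A. x u)\<^sup>2"
  shows "F V - 2 * (\<Sum>u\<in>V. (x u)\<^sup>2) + F T - (\<Sum>C\<in>P. F C)
    \<le> (\<Sum>u\<in>V. \<Sum>v\<in>V. d u v * (x u + x v)\<^sup>2) / 2"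
proof -
  let ?h = "\<lambda>u v. (x u + x v)\<^sup>2" and ?I = "\<lambda>A u v. of_bool (u \<in> A \<and> v \<in> A) :: real"
  have finP: "finite P" using P fin T by (meson finite_elements finite_subset)
  have CV: "C \<subseteq> V" if "C \<in> P" for C using that P T by (auto simp: partition_on_def)
  have pointwise: "?I V u v - of_bool (u = v) + ?I T u v - (\<Sum>C\<in>P. ?I C u v) \<le> d u v"
    if uv: "u \<in> V" "v \<in> V" for u v
  proof -
    have nonneg: "0 \<le> (\<Sum>C\<in>P. ?I C u v)" by (intro sum_nonneg) auto
    show ?thesis
    proof (cases "u \<in> T \<and> v \<in> T")
      case True
      then obtain C D where CD: "C \<in> P" "D \<in> P" "u \<in> C" "v \<in> D"
        using P by (auto simp: partition_on_def)
      show ?thesis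
      proof (cases "C = D")
        case True
        have "?I C u v \<le> (\<Sum>C\<in>P. ?I C u v)"
          using CD finP by (intro member_le_sum) auto
        then have "1 \<le> (\<Sum>C\<in>P. ?I C u v)" using CD True by simp
        then show ?thesis using d0[of u v] d1[OF uv] uv by (cases "u = v") (auto simp: of_bool_def)
      next
        case False
        then have "2 \<le> d u v" using d2 CD by blast
        then show ?thesis using nonneg by (auto simp: of_bool_def)
      qed
    next
      case False
      then show ?thesis using nonneg d0[of u v] d1[OF uv] by (cases "u = v") (auto simp: of_bool_def)
    qed
  qed
  have I: "(\<Sum>u\<in>V. \<Sum>v\<in>V. ?I A u v * ?h u v) = 2 * F A" if "A \<subseteq> V" for A
    using sum_sum_restrict[OF fin that, of ?h] by (simp add: sum_sum_add_square F_def)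
  have diag: "(\<Sum>u\<in>V. \<Sum>v\<in>V. of_bool (u = v) * ?h u v) = 4 * (\<Sum>u\<in>V. (x u)\<^sup>2)"
  proof -
    have "(\<Sum>v\<in>V. of_bool (u = v) * ?h u v) = 4 * (x u)\<^sup>2" if "u \<in> V" for u
    proof -
      have "(\<Sum>v\<in>V. of_bool (u = v) * ?h u v) = (\<Sum>v\<in>V. if u = v then 4 * (x v)\<^sup>2 else 0)"
        by (intro sum.cong) (auto simp: power2_eq_square)
      then show ?thesis using fin that by simp
    qed
    then show ?thesis by (simp add: sum_distrib_left)
  qed
  have parts: "(\<Sum>u\<in>V. \<Sum>v\<in>V. (\<Sum>C\<in>P. ?I C u v) * ?h u v) = 2 * (\<Sum>C\<in>P. F C)"
  proof -
    have "(\<Sum>u\<in>V. \<Sum>v\<in>V. (\<Sum>C\<in>P. ?I C u v) * ?h u v) = (\<Sum>u\<in>V. \<Sum>v\<in>V. \<Sum>C\<in>P. ?I C u v * ?h u v)"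
      by (simp add: sum_distrib_right)
    also have "\<dots> = (\<Sum>u\<in>V. \<Sum>C\<in>P. \<Sum>v\<in>V. ?I C u v * ?h u v)"
      by (intro sum.cong refl sum.swap)
    also have "\<dots> = (\<Sum>C\<in>P. \<Sum>u\<in>V. \<Sum>v\<in>V. ?I C u v * ?h u v)" by (rule sum.swap)
    also have "\<dots> = (\<Sum>C\<in>P. 2 * F C)" using I CV by (intro sum.cong) auto
    finally show ?thesis by (simp add: sum_distrib_left)
  qed
  have "2 * (F V - 2 * (\<Sum>u\<in>V. (x u)\<^sup>2) + F T - (\<Sum>C\<in>P. F C)) =
      (\<Sum>u\<in>V. \<Sum>v\<in>V. (?I V u v - of_bool (u = v) + ?I T u v - (\<Sum>C\<in>P. ?I C u v)) * ?h u v)"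
    unfolding left_diff_distrib distrib_right sum.distrib sum_subtractf I[OF order_refl] I[OF T] diag parts
    by simp
  also have "\<dots> \<le> (\<Sum>u\<in>V. \<Sum>v\<in>V. d u v * ?h u v)"
    using pointwise by (intro sum_mono mult_right_mono) auto
  finally show ?thesis by simp
qed

text \<open>The witness takes the value \<open>a\<close> on \<open>S\<close>, \<open>c\<close> on one vertex of every part but the largest, and
  \<open>b\<close> elsewhere. For the partition into one large part and singletons the bound is an equality; for
  any other one, the lost pairs of values \<open>{b, c}\<close> are outweighed by the new pairs \<open>{b, b}\<close>.\<close>

lemma odd_partition_form_ge:
  fixes d :: "'a \<Rightarrow> 'a \<Rightarrow> real" and a b c :: real
  assumes fin: "finite V" and S: "S \<subseteq> V" and P: "partition_on (V - S) P"
    and cardP: "card P = card S + 2" and odd: "\<And>C. C \<in> P \<Longrightarrow> odd (card C)"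
    and d0: "\<And>u v. 0 \<le> d u v" and d1: "\<And>u v. u \<in> V \<Longrightarrow> v \<in> V \<Longrightarrow> u \<noteq> v \<Longrightarrow> 1 \<le> d u v"
    and d2: "\<And>C D u v. C \<in> P \<Longrightarrow> D \<in> P \<Longrightarrow> C \<noteq> D \<Longrightarrow> u \<in> C \<Longrightarrow> v \<in> D \<Longrightarrow> 2 \<le> d u v"
  defines "n \<equiv> real (card V)" and "s \<equiv> real (card S)"
  defines "m \<equiv> n - 2 * s - 1"
  assumes ratio: "5 \<le> m \<Longrightarrow> (b + c)\<^sup>2 \<le> 2 * m * b\<^sup>2"
  obtains x :: "'a \<Rightarrow> real" where
    "(\<Sum>u\<in>V. (x u)\<^sup>2) = s * a\<^sup>2 + m * b\<^sup>2 + (s + 1) * c\<^sup>2"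
    "(n - 2) * (s * a\<^sup>2 + m * b\<^sup>2 + (s + 1) * c\<^sup>2) + (s * a + m * b + (s + 1) * c)\<^sup>2
      + 2 * s * (s + 1) * c\<^sup>2 + m * (s + 1) * (b + c)\<^sup>2
      \<le> (\<Sum>u\<in>V. \<Sum>v\<in>V. d u v * (x u + x v)\<^sup>2) / 2"
proof -
  let ?T = "V - S"
  have finT: "finite ?T" using fin by simp
  have finP: "finite P" using P finT by (rule finite_elements[rotated])
  have U: "\<Union>P = ?T" and dis: "\<And>C D. C \<in> P \<Longrightarrow> D \<in> P \<Longrightarrow> C \<noteq> D \<Longrightarrow> C \<inter> D = {}" and ne: "{} \<notin> P"
    using P by (auto simp: partition_on_def pairwise_def disjnt_def)
  have CT: "C \<subseteq> ?T" if "C \<in> P" for C using that U by blast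
  have finC: "finite C" if "C \<in> P" for C using CT[OF that] finT by (rule finite_subset)
  have "P \<noteq> {}" using cardP by auto
  then obtain D where D: "D \<in> P" and Dmax: "\<And>C. C \<in> P \<Longrightarrow> card C \<le> card D"
    using ex_has_greatest_nat[of "\<lambda>C. C \<in> P" _ card "Suc (card ?T)"] CT finT
    by (metis card_mono ex_in_conv less_Suc_eq_le)
  define P' where "P' = P - {D}"
  have PD: "P = insert D P'" "D \<notin> P'" and finP': "finite P'" using D finP by (auto simp: P'_def)
  have cardP': "real (card P') = s + 1" using PD finP' cardP by (simp add: s_def)
  have "\<forall>C\<in>P. \<exists>u. u \<in> C" using ne by (metis ex_in_conv)
  then obtain w where w: "\<And>C. C \<in> P \<Longrightarrow> w C \<in> C" by metis
  define x where "x u = (if u \<in> S then a else if u \<in> w ` P' then c else b)" for u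
  \<comment> \<open>For a part other than \<open>D\<close>, the number of its vertices with value
    \<open>b\<close>, that is, all but the representative \<open>w C\<close>.\<close>
  define k where "k C = real (card C) - 1" for C :: "'a set"
  have card_k: "real (card C) = 1 + k C" for C :: "'a set" by (simp add: k_def)
  have sumS: "(\<Sum>u\<in>S. f (x u)) = s * f a" for f :: "real \<Rightarrow> real"
    by (simp add: x_def s_def)
  have sumC: "(\<Sum>u\<in>C. f (x u)) = f c + k C * f b" if C: "C \<in> P'" for C and f :: "real \<Rightarrow> real"
  proof -
    have CP: "C \<in> P" using C by (simp add: P'_def)
    have xw: "x (w C) = c" using w[OF CP] CT[OF CP] C by (auto simp: x_def)
    have xb: "x u = b" if u: "u \<in> C - {w C}" for u
    proof -
      have "u \<notin> w ` P'"
      proof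
        assume "u \<in> w ` P'"
        then obtain C' where C': "C' \<in> P'" "u = w C'" by blast
        then have "C' \<in> P" "u \<in> C'" using w by (auto simp: P'_def)
        then have "C' = C" using dis[OF _ CP, of C'] u by blast
        then show False using C' u by simp
      qed
      moreover have "u \<notin> S" using CT[OF CP] u by blast
      ultimately show ?thesis by (simp add: x_def)
    qed
    have "(\<Sum>u\<in>C. f (x u)) = f (x (w C)) + (\<Sum>u\<in>C - {w C}. f (x u))"
      using w[OF CP] finC[OF CP] by (simp add: sum.remove)
    also have "(\<Sum>u\<in>C - {w C}. f (x u)) = real (card (C - {w C})) * f b"
      using xb by simp
    also have "real (card (C - {w C})) = k C"
      using w[OF CP] finC[OF CP] card_gt_0_iff[of C] by (auto simp: k_def of_nat_diff Suc_leI)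
    finally show ?thesis by (simp add: xw)
  qed
  have sumD: "(\<Sum>u\<in>D. f (x u)) = real (card D) * f b" for f :: "real \<Rightarrow> real"
  proof -
    have "x u = b" if "u \<in> D" for u
    proof -
      have "u \<notin> w ` P'"
      proof
        assume "u \<in> w ` P'"
        then obtain C' where C': "C' \<in> P'" "u = w C'" by blast
        then have "C' \<in> P" "C' \<noteq> D" "u \<in> C'" using w PD by auto
        then show False using dis[OF _ D, of C'] that by blast
      qed
      moreover have "u \<notin> S" using CT[OF D] that by blast
      ultimately show ?thesis by (simp add: x_def)
    qed
    then show ?thesis by simp
  qed
  define B where "B = (\<Sum>C\<in>P'. k C)"
  have sumT: "(\<Sum>u\<in>?T. f (x u)) = (real (card D) + B) * f b + (s + 1) * f c"
    for f :: "real \<Rightarrow> real"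
  proof -
    have "(\<Sum>u\<in>?T. f (x u)) = (\<Sum>C\<in>P. \<Sum>u\<in>C. f (x u))"
      unfolding U[symmetric] using finC dis by (subst sum.Union_disjoint) auto
    also have "\<dots> = (\<Sum>u\<in>D. f (x u)) + (\<Sum>C\<in>P'. \<Sum>u\<in>C. f (x u))"
      using PD finP' by simp
    also have "(\<Sum>C\<in>P'. \<Sum>u\<in>C. f (x u)) = (\<Sum>C\<in>P'. f c + k C * f b)"
      using sumC by (intro sum.cong) auto
    also have "\<dots> = (s + 1) * f c + B * f b"
      by (simp add: sum.distrib cardP' B_def sum_distrib_right)
    finally show ?thesis by (simp add: sumD algebra_simps)
  qed
  have cardT: "real (card ?T) = n - s"
    using S fin by (simp add: n_def s_def card_Diff_subset finite_subset of_nat_diff card_mono)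
  \<comment> \<open>Whatever the part sizes, exactly \<open>m\<close> vertices have value
    \<open>b\<close>, so the norm and the sum of the entries agree with those on the extremal
    graph.\<close>
  have m: "m = real (card D) + B" and cardT': "real (card ?T) = m + (s + 1)"
    using sumT[of "\<lambda>_. 1"] cardT by (simp_all add: m_def)
  have sumV: "(\<Sum>u\<in>V. f (x u)) = s * f a + m * f b + (s + 1) * f c" for f :: "real \<Rightarrow> real"
    using sum.subset_diff[OF S fin, of "\<lambda>u. f (x u)"] sumT[of f] sumS[of f] m by simp
  have k0: "0 \<le> k C" if "C \<in> P'" for C
    using that finC[of C] ne card_gt_0_iff[of C] by (auto simp: k_def P'_def Suc_leI)
  have kD: "k C \<le> real (card D)" if "C \<in> P'" for C
    using that Dmax[of C] by (simp add: k_def P'_def)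
  have B0: "0 \<le> B" using k0 by (simp add: B_def sum_nonneg)
  \<comment> \<open>Something is lost only if a part besides \<open>D\<close> has more than one
    vertex. By oddness it has at least 3, so \<open>card D \<ge> 3\<close> and
    \<open>B \<ge> 2\<close>; hence \<open>m \<ge> 5\<close> and \<open>ratio\<close>
    applies.\<close>
  have loss: "(b + c)\<^sup>2 * B \<le> 2 * m * b\<^sup>2 * B"
  proof (cases "B = 0")
    case False
    have "\<exists>C\<in>P'. k C \<noteq> 0" using False by (auto simp: B_def intro: ccontr)
    then obtain C where C: "C \<in> P'" "k C \<noteq> 0" by blast
    have CP: "C \<in> P" using C by (simp add: P'_def)
    have "card C \<noteq> 1" "odd (card C)" using C odd[OF CP] by (auto simp: k_def)
    then have "3 \<le> card C" by presburger
    moreover have "card C \<le> card D" using Dmax CP by blast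
    moreover have "k C \<le> B" unfolding B_def using C(1) k0 finP' by (intro member_le_sum) auto
    ultimately have "5 \<le> m" unfolding m by (simp add: k_def)
    then show ?thesis using ratio B0 by (intro mult_right_mono) auto
  qed simp
  define F where "F A = real (card A) * (\<Sum>u\<in>A. (x u)\<^sup>2) + (\<Sum>u\<in>A. x u)\<^sup>2" for A
  have FC: "F C \<le> 2 * c\<^sup>2 + ((b + c)\<^sup>2 + 2 * b\<^sup>2 * real (card D)) * k C" if C: "C \<in> P'" for C
  proof -
    have "F C = 2 * c\<^sup>2 + (b + c)\<^sup>2 * k C + 2 * b\<^sup>2 * (k C * k C)"
      unfolding F_def using sumC[OF C, of "\<lambda>t. t\<^sup>2"] sumC[OF C, of "\<lambda>t. t"]
      by (simp add: card_k power2_eq_square algebra_simps)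
    \<comment> \<open>Maximality of \<open>D\<close> linearizes the bound in \<open>k C\<close>, so
      that summing over the parts involves only \<open>B\<close>.\<close>
    moreover have "2 * b\<^sup>2 * (k C * k C) \<le> 2 * b\<^sup>2 * (real (card D) * k C)"
      using k0[OF C] kD[OF C] by (intro mult_left_mono mult_right_mono) auto
    ultimately show ?thesis by (simp add: algebra_simps)
  qed
  have "(\<Sum>C\<in>P. F C) = F D + (\<Sum>C\<in>P'. F C)" using PD finP' by simp
  also have "(\<Sum>C\<in>P'. F C) \<le> (\<Sum>C\<in>P'. 2 * c\<^sup>2 + ((b + c)\<^sup>2 + 2 * b\<^sup>2 * real (card D)) * k C)"
    using FC by (intro sum_mono)
  also have "\<dots> = 2 * (s + 1) * c\<^sup>2 + ((b + c)\<^sup>2 + 2 * b\<^sup>2 * real (card D)) * B"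
    by (simp add: sum.distrib cardP' B_def sum_distrib_left)
  also have "F D = 2 * b\<^sup>2 * (real (card D) * real (card D))"
    unfolding F_def using sumD[of "\<lambda>t. t\<^sup>2"] sumD[of "\<lambda>t. t"]
    by (simp add: power2_eq_square algebra_simps)
  finally have "(\<Sum>C\<in>P. F C) \<le> 2 * (s + 1) * c\<^sup>2 + 2 * m * b\<^sup>2 * B + 2 * m * b\<^sup>2 * real (card D)"
    using loss by (simp add: m algebra_simps)
  \<comment> \<open>The right side is the value for one part of size \<open>m\<close> with constant
    value \<open>b\<close> and \<open>s + 1\<close> singletons of value \<open>c\<close>.\<close>
  then have parts: "(\<Sum>C\<in>P. F C) \<le> 2 * (s + 1) * c\<^sup>2 + 2 * m\<^sup>2 * b\<^sup>2"
    unfolding power2_eq_square[of m] by (simp add: m algebra_simps)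
  have FV: "F V = n * (s * a\<^sup>2 + m * b\<^sup>2 + (s + 1) * c\<^sup>2) + (s * a + m * b + (s + 1) * c)\<^sup>2"
    unfolding F_def using sumV[of "\<lambda>t. t\<^sup>2"] sumV[of "\<lambda>t. t"] by (simp add: n_def)
  have "F ?T = (m + (s + 1)) * (m * b\<^sup>2 + (s + 1) * c\<^sup>2) + (m * b + (s + 1) * c)\<^sup>2"
    unfolding F_def cardT' using sumT[of "\<lambda>t. t\<^sup>2"] sumT[of "\<lambda>t. t"] by (simp add: m[symmetric])
  also have "\<dots> = 2 * (s + 1) * c\<^sup>2 + 2 * m\<^sup>2 * b\<^sup>2 + 2 * s * (s + 1) * c\<^sup>2 + m * (s + 1) * (b + c)\<^sup>2"
    by (simp add: power2_eq_square algebra_simps)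
  finally have FT: "F ?T = \<dots>" .
  have norm: "(\<Sum>u\<in>V. (x u)\<^sup>2) = s * a\<^sup>2 + m * b\<^sup>2 + (s + 1) * c\<^sup>2" using sumV[of "\<lambda>t. t\<^sup>2"] by simp
  have "F V - 2 * (\<Sum>u\<in>V. (x u)\<^sup>2) + F ?T - (\<Sum>C\<in>P. F C)
    \<le> (\<Sum>u\<in>V. \<Sum>v\<in>V. d u v * (x u + x v)\<^sup>2) / 2"
    unfolding F_def using fin P d0 d1 d2 by (intro partitioned_form_ge) auto
  then have "(n - 2) * (s * a\<^sup>2 + m * b\<^sup>2 + (s + 1) * c\<^sup>2) + (s * a + m * b + (s + 1) * c)\<^sup>2
      + 2 * s * (s + 1) * c\<^sup>2 + m * (s + 1) * (b + c)\<^sup>2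
      \<le> (\<Sum>u\<in>V. \<Sum>v\<in>V. d u v * (x u + x v)\<^sup>2) / 2"
    using parts unfolding FV FT norm left_diff_distrib by linarith
  with norm show ?thesis by (rule that)
qed

section \<open>The cubic of the extremal graph\<close>

text \<open>The characteristic polynomial of the quotient matrix of the distance signless Laplacian of the
  join of \<open>K\<^sub>s\<close> with \<open>K\<^sub>m \<union> (s + 1) K\<^sub>1\<close>, where \<open>m = n - 2 s - 1\<close>.\<close>

definition extremal_cubic :: "real \<Rightarrow> real \<Rightarrow> real \<Rightarrow> real" where
  "extremal_cubic n s x = x ^ 3 - (5 * n + s - 6) * x\<^sup>2
     + (8 * s\<^sup>2 + (8 - n) * s + 8 * n\<^sup>2 - 24 * n + 16) * x
     - 2 * s ^ 3 + (14 - 8 * n) * s\<^sup>2 + (2 * n\<^sup>2 - 14 * n + 20) * s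
     - 4 * n ^ 3 + 20 * n\<^sup>2 - 32 * n + 16"

text \<open>The values \<open>a\<close>, \<open>b\<close>, \<open>c\<close> on the three blocks solve the eigenvalue equations of the first two
  blocks, so that only the defect of the third one remains.\<close>

lemma extremal_form_eq:
  fixes n s l :: real
  defines "m \<equiv> n - 2 * s - 1" and "p \<equiv> l - n - s + 2" and "q \<equiv> l - 2 * n + s + 2"
  defines "a \<equiv> (s + 1) * (q + 2 * m)" and "b \<equiv> (s + 1) * (2 * p + s)" and "c \<equiv> p * q - s * m"
  shows "(n - 2) * (s * a\<^sup>2 + m * b\<^sup>2 + (s + 1) * c\<^sup>2) + (s * a + m * b + (s + 1) * c)\<^sup>2
      + 2 * s * (s + 1) * c\<^sup>2 + m * (s + 1) * (b + c)\<^sup>2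
      - l * (s * a\<^sup>2 + m * b\<^sup>2 + (s + 1) * c\<^sup>2) = - ((s + 1) * c * extremal_cubic n s l)"
proof -
  have row1: "m * b + (s + 1) * c = p * a" and row2: "s * a + 2 * (s + 1) * c = q * b"
    by (simp_all add: a_def b_def c_def algebra_simps)
  have row3: "s * a + 2 * m * b - (l - 2 * n - s + 2) * c = - extremal_cubic n s l"
    by (simp add: a_def b_def c_def m_def p_def q_def extremal_cubic_def
        power2_eq_square power3_eq_cube algebra_simps)
  \<comment> \<open>Grouped by blocks: each term is block size times value times the defect of that
    block's eigenvalue equation.\<close>
  have "(n - 2) * (s * a\<^sup>2 + m * b\<^sup>2 + (s + 1) * c\<^sup>2) + (s * a + m * b + (s + 1) * c)\<^sup>2
      + 2 * s * (s + 1) * c\<^sup>2 + m * (s + 1) * (b + c)\<^sup>2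
      - l * (s * a\<^sup>2 + m * b\<^sup>2 + (s + 1) * c\<^sup>2)
    = s * a * (m * b + (s + 1) * c - p * a) + m * b * (s * a + 2 * (s + 1) * c - q * b)
      + (s + 1) * c * (s * a + 2 * m * b - (l - 2 * n - s + 2) * c)"
    unfolding m_def p_def q_def by (simp add: power2_eq_square algebra_simps)
  then show ?thesis unfolding row1 row2 row3 by simp
qed

text \<open>Comparison with \<open>s = 1\<close> near \<open>2 * n\<close>: the difference vanishes
  at \<open>s = 1\<close>, and the sign of the remaining factor, quadratic in \<open>s\<close>,
  decides.\<close>

lemma extremal_cubic_shift:
  "extremal_cubic n s (2 * n + y) = extremal_cubic n 1 (2 * n + y) +
    (s - 1) * (- 2 * s\<^sup>2 + (8 * y + 8 * n + 12) * s - y\<^sup>2 - (5 * n - 16) * y - 4 * n\<^sup>2 + 10 * n + 32)"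
  by (simp add: extremal_cubic_def power2_eq_square power3_eq_cube algebra_simps)

lemma extremal_cubic_one_shift:
  "extremal_cubic n 1 (2 * n + y) =
    y ^ 3 + (n + 5) * y\<^sup>2 - (5 * n - 32) * y - (8 * n\<^sup>2 - 10 * n - 48)"
  by (simp add: extremal_cubic_def power2_eq_square power3_eq_cube algebra_simps)

text \<open>At a root for \<open>s = 1\<close> only \<open>(s - 1) * g s\<close> remains. On the
  admissible range \<open>g\<close> is largest at the right end \<open>t = n / 2 - 1\<close>, where
  \<open>n \<ge> 12\<close> and \<open>y \<ge> 7\<close> make it negative.\<close>

lemma extremal_cubic_nonpos_if_root_one:
  assumes n: "12 \<le> n" and s: "1 \<le> s" "2 * s + 2 \<le> n" and y: "7 \<le> y"
    and root: "extremal_cubic n 1 (2 * n + y) = 0"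
  shows "extremal_cubic n s (2 * n + y) \<le> 0"
proof -
  define g where "g t = - 2 * t\<^sup>2 + (8 * y + 8 * n + 12) * t - y\<^sup>2 - (5 * n - 16) * y - 4 * n\<^sup>2 + 10 * n + 32"
    for t
  define t where "t = n / 2 - 1"
  have "g s = g t - (t - s) * (8 * y + 8 * n + 12 - 2 * (s + t))"
    by (simp add: g_def power2_eq_square algebra_simps)
  moreover have "0 \<le> (t - s) * (8 * y + 8 * n + 12 - 2 * (s + t))"
    using n s y by (intro mult_nonneg_nonneg) (auto simp: t_def)
  moreover have "g t = - (n - 12) * (n + 6) / 2 - 11 - (y - 7) * (y + n - 1)"
    by (simp add: g_def t_def power2_eq_square field_simps)
  moreover have "0 \<le> (n - 12) * (n + 6)" "0 \<le> (y - 7) * (y + n - 1)"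
    using n y by (simp_all add: mult_nonneg_nonneg)
  ultimately have "g s \<le> 0" by linarith
  then have "(s - 1) * g s \<le> 0" using s by (simp add: mult_nonneg_nonpos)
  then show ?thesis using root unfolding extremal_cubic_shift[of n s] g_def by simp
qed

section \<open>Roots of the cubic and the threshold\<close>

lemma theta_eq: "theta n = Max {x. extremal_cubic (real n) 1 x = 0}"
proof -
  have "(\<lambda>x. x ^ 3 + (5 - 5 * real n) * x ^ 2 + (8 * real n ^ 2 - 25 * real n + 32) * x
       - 4 * real n ^ 3 + 22 * real n ^ 2 - 54 * real n + 48) = extremal_cubic (real n) 1"
    by (rule ext) (simp add: extremal_cubic_def algebra_simps)
  then show ?thesis unfolding theta_def by (metis (no_types, lifting))
qed

lemma finite_extremal_cubic_roots: "finite {x. extremal_cubic n s x = 0}"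
proof -
  define r where "r = [:- 2 * s ^ 3 + (14 - 8 * n) * s\<^sup>2 + (2 * n\<^sup>2 - 14 * n + 20) * s
     - 4 * n ^ 3 + 20 * n\<^sup>2 - 32 * n + 16, 8 * s\<^sup>2 + (8 - n) * s + 8 * n\<^sup>2 - 24 * n + 16,
     - (5 * n + s - 6), 1:]"
  have "extremal_cubic n s x = poly r x" for x
    by (simp add: r_def extremal_cubic_def power2_eq_square power3_eq_cube algebra_simps)
  moreover have "r \<noteq> 0" by (simp add: r_def)
  ultimately show ?thesis using poly_roots_finite[of r] by simp
qed

text \<open>The intermediate value theorem gives a root between \<open>2 * n + y\<close> and
  \<open>6 * n\<close>. It also shows that the root set is nonempty, so that its \<open>Max\<close>
  is itself a root.\<close>

lemma theta_ge:
  assumes "4 \<le> n" "0 \<le> y" "y \<le> 4 * real n" "extremal_cubic (real n) 1 (2 * real n + y) \<le> 0"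
  shows "2 * real n + y \<le> theta n" and "extremal_cubic (real n) 1 (theta n) = 0"
proof -
  let ?f = "extremal_cubic (real n) 1"
  have "?f (2 * real n + 4 * real n) =
      80 * real n ^ 3 + 52 * (real n)\<^sup>2 + 138 * real n + 48"
    unfolding extremal_cubic_one_shift by (simp add: power2_eq_square power3_eq_cube algebra_simps)
  then have pos: "0 \<le> ?f (2 * real n + 4 * real n)" by simp
  have "continuous_on {2 * real n + y..2 * real n + 4 * real n} ?f"
    unfolding extremal_cubic_def by (intro continuous_intros)
  then obtain x where x: "2 * real n + y \<le> x" "?f x = 0"
    using IVT'[of ?f "2 * real n + y" 0 "2 * real n + 4 * real n"] assms pos by auto
  have fin: "finite {x. ?f x = 0}" by (rule finite_extremal_cubic_roots)
  have "x \<le> theta n" unfolding theta_eq using fin x(2) by (intro Max_ge) auto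
  then show "2 * real n + y \<le> theta n" using x(1) by simp
  have "theta n \<in> {x. ?f x = 0}" unfolding theta_eq using fin x(2) by (intro Max_in) auto
  then show "?f (theta n) = 0" by simp
qed

text \<open>At the shift \<open>z\<close> with equality in the claim the cubic is positive, and it
  is no smaller at any larger shift. The bound is the one required by
  \<open>extremal_vector_ratio\<close>.\<close>

lemma extremal_cubic_root_le:
  assumes n: "12 \<le> n" and y: "7 \<le> y" and root: "extremal_cubic n 1 (2 * n + y) = 0"
  shows "(y + 3)\<^sup>2 \<le> 16 * (n - 4)"
proof (rule ccontr)
  assume "\<not> ?thesis"
  then have gt: "sqrt (16 * (n - 4)) < y + 3"
    using y by (simp add: real_less_lsqrt not_le)
  define z where "z = sqrt (16 * (n - 4)) - 3"
  have "8 \<le> sqrt (16 * (n - 4))" using n by (intro real_le_rsqrt) simp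
  then have z: "5 \<le> z" "z \<le> y" using gt by (auto simp: z_def)
  have "(z + 3)\<^sup>2 = 16 * (n - 4)" using n by (simp add: z_def)
  \<comment> \<open>This relation lowers the degree in \<open>z\<close>, leaving an expression whose
    sign is evident for \<open>n \<ge> 12\<close>.\<close>
  then have zz: "z\<^sup>2 = 16 * n - 73 - 6 * z" by (simp add: power2_eq_square algebra_simps)
  have "extremal_cubic n 1 (2 * n + z) = z\<^sup>2 * (z + n + 5) - (5 * n - 32) * z - (8 * n\<^sup>2 - 10 * n - 48)"
    unfolding extremal_cubic_one_shift by (simp add: power2_eq_square power3_eq_cube algebra_simps)
  also have "\<dots> = (16 * n - 73 - 6 * z) * (z + n + 5) - (5 * n - 32) * z - (8 * n\<^sup>2 - 10 * n - 48)"
    by (simp only: zz)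
  also have "\<dots> = 8 * n\<^sup>2 + 17 * n + 5 * (n * z) - 71 * z - 6 * z\<^sup>2 - 317"
    by (simp add: power2_eq_square algebra_simps)
  also have "\<dots> = 8 * n * (n - 12) + 17 * n + 121 + 5 * (n - 7) * z"
    unfolding zz by (simp add: power2_eq_square algebra_simps)
  also have "\<dots> > 0"
    using n z by (intro add_pos_nonneg add_nonneg_pos mult_nonneg_nonneg) auto
  finally have "0 < extremal_cubic n 1 (2 * n + z)" .
  moreover have "extremal_cubic n 1 (2 * n + y) - extremal_cubic n 1 (2 * n + z) =
      (y - z) * (y\<^sup>2 + y * z + z\<^sup>2 + (n + 5) * (y + z - 5) + 57)"
    unfolding extremal_cubic_one_shift by (simp add: power2_eq_square power3_eq_cube algebra_simps)
  moreover have "0 \<le> (y - z) * (y\<^sup>2 + y * z + z\<^sup>2 + (n + 5) * (y + z - 5) + 57)"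
    using n y z by (intro mult_nonneg_nonneg add_nonneg_nonneg) auto
  ultimately show False using root by linarith
qed

text \<open>For the finitely many pairs of \<open>n\<close> and \<open>s\<close>, the value of
  \<open>r * r\<close> reduces every claim to a linear one in \<open>r\<close>, settled by decimal
  bounds. The last bound fails at \<open>n = 6\<close>, where \<open>m \<ge> 5\<close> cannot occur
  for \<open>s \<ge> 1\<close>.\<close>

lemma extremal_cubic_nonpos_small:
  assumes "n = 6 \<or> n = 8 \<or> n = (10 :: nat)" "1 \<le> s" "2 * s + 2 \<le> n"
  defines "l \<equiv> 2 * real n + sqrt (real n * (real n + 2) / 2) - 2"
  shows "extremal_cubic (real n) (real s) l \<le> 0" and "2 * real n \<le> l"
    and "8 \<le> n \<Longrightarrow> (l - 2 * real n + 3)\<^sup>2 \<le> 16 * (real n - 4)"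
proof -
  define r where "r = sqrt (real n * (real n + 2) / 2)"
  have r0: "0 \<le> r" and rr: "r * r = real n * (real n + 2) / 2" by (simp_all add: r_def)
  have l: "l = 2 * real n + r - 2" by (simp add: l_def r_def)
  have cub: "extremal_cubic (real n) (real s) l \<le> 0 \<and> 2 * real n \<le> l \<and>
      (8 \<le> n \<longrightarrow> (l - 2 * real n + 3)\<^sup>2 \<le> 16 * (real n - 4))"
    using assms(1)
  proof (elim disjE)
    assume n: "n = 6"
    have rr: "r * r = 24" using rr n by simp
    have "4.89 \<le> r"
      unfolding r_def n by (rule real_le_rsqrt) (simp add: power2_eq_square)
    moreover have "r \<le> 4.9"
      unfolding r_def n by (rule real_le_lsqrt) (simp_all add: power2_eq_square)
    moreover have "s = 1 \<or> s = 2" using assms n by auto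
    ultimately show ?thesis using rr
      by (auto simp: l n extremal_cubic_def power2_eq_square power3_eq_cube algebra_simps)
  next
    assume n: "n = 8"
    have rr: "r * r = 40" using rr n by simp
    have "6.32 \<le> r"
      unfolding r_def n by (rule real_le_rsqrt) (simp add: power2_eq_square)
    moreover have "r \<le> 6.33"
      unfolding r_def n by (rule real_le_lsqrt) (simp_all add: power2_eq_square)
    moreover have "s = 1 \<or> s = 2 \<or> s = 3" using assms n by auto
    ultimately show ?thesis using rr
      by (auto simp: l n extremal_cubic_def power2_eq_square power3_eq_cube algebra_simps)
  next
    assume n: "n = 10"
    have rr: "r * r = 60" using rr n by simp
    have "7.74 \<le> r"
      unfolding r_def n by (rule real_le_rsqrt) (simp add: power2_eq_square)
    moreover have "r \<le> 7.75"
      unfolding r_def n by (rule real_le_lsqrt) (simp_all add: power2_eq_square)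
    moreover have "s = 1 \<or> s = 2 \<or> s = 3 \<or> s = 4" using assms n by auto
    ultimately show ?thesis using rr
      by (auto simp: l n extremal_cubic_def power2_eq_square power3_eq_cube algebra_simps)
  qed
  then show "extremal_cubic (real n) (real s) l \<le> 0" and "2 * real n \<le> l"
    and "8 \<le> n \<Longrightarrow> (l - 2 * real n + 3)\<^sup>2 \<le> 16 * (real n - 4)" by blast+
qed

lemma threshold_properties:
  assumes "4 \<le> n" "even n" "1 \<le> s" "2 * s + 2 \<le> n"
  defines "l \<equiv> (if n = 4 \<or> n \<ge> 12 then theta n
                 else 2 * real n + sqrt (real n * (real n + 2) / 2) - 2)"
  shows "2 * real n \<le> l" and "extremal_cubic (real n) (real s) l \<le> 0"
    and "8 \<le> n \<Longrightarrow> (l - 2 * real n + 3)\<^sup>2 \<le> 16 * (real n - 4)"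
proof -
  consider "n = 4" | "n = 6 \<or> n = 8 \<or> n = 10" | "12 \<le> n" using assms(1,2) by fastforce
  then have "2 * real n \<le> l \<and> extremal_cubic (real n) (real s) l \<le> 0 \<and>
    (8 \<le> n \<longrightarrow> (l - 2 * real n + 3)\<^sup>2 \<le> 16 * (real n - 4))"
  proof cases
    case 1
    then have "s = 1" using assms by simp
    \<comment> \<open>For \<open>n = 4\<close> the shift 0 suffices: the cubic has the value -40
      there.\<close>
    moreover have "extremal_cubic (real n) 1 (2 * real n + 0) \<le> 0"
      unfolding extremal_cubic_one_shift using 1 by simp
    then have "2 * real n \<le> theta n" "extremal_cubic (real n) 1 (theta n) = 0"
      using theta_ge[of n 0] assms(1) by auto
    ultimately show ?thesis using 1 by (simp add: l_def)
  next
    case 2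
    then have "l = 2 * real n + sqrt (real n * (real n + 2) / 2) - 2" by (auto simp: l_def)
    then show ?thesis using extremal_cubic_nonpos_small[OF 2 assms(3,4)] by blast
  next
    case 3
    then have l: "l = theta n" by (simp add: l_def)
    define y where "y = theta n - 2 * real n"
    \<comment> \<open>The shift 7 is the lower bound on \<open>y\<close> that the comparison of
      \<open>s\<close> with 1 needs.\<close>
    have "extremal_cubic (real n) 1 (2 * real n + 7) = - 8 * (real n - 12) * (real n + 9) - 4"
      unfolding extremal_cubic_one_shift by (simp add: power2_eq_square algebra_simps)
    also have "\<dots> \<le> 0"
    proof -
      have "0 \<le> (real n - 12) * (real n + 9)" using 3 by (intro mult_nonneg_nonneg) auto
      then show ?thesis by linarith
    qed
    finally have "2 * real n + 7 \<le> theta n" "extremal_cubic (real n) 1 (theta n) = 0"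
      using theta_ge[of n 7] 3 by auto
    then have y: "7 \<le> y" "extremal_cubic (real n) 1 (2 * real n + y) = 0" by (auto simp: y_def)
    have n: "12 \<le> real n" using 3 by simp
    have "extremal_cubic (real n) (real s) (2 * real n + y) \<le> 0"
      using assms(3,4) by (intro extremal_cubic_nonpos_if_root_one[OF n _ _ y]) (auto simp flip: of_nat_add)
    moreover have "(y + 3)\<^sup>2 \<le> 16 * (real n - 4)" by (rule extremal_cubic_root_le[OF n y])
    ultimately show ?thesis using y(1) by (simp add: l y_def)
  qed
  then show "2 * real n \<le> l" and "extremal_cubic (real n) (real s) l \<le> 0"
    and "8 \<le> n \<Longrightarrow> (l - 2 * real n + 3)\<^sup>2 \<le> 16 * (real n - 4)" by blast+
qed

section \<open>Sign and ratio of the test values\<close>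

lemma extremal_vector_positive:
  fixes n s l :: real
  defines "m \<equiv> n - 2 * s - 1" and "p \<equiv> l - n - s + 2" and "q \<equiv> l - 2 * n + s + 2"
  defines "b \<equiv> (s + 1) * (2 * p + s)" and "c \<equiv> p * q - s * m"
  assumes "1 \<le> s" "2 * s + 2 \<le> n" "2 * n \<le> l"
  shows "0 < b" "0 < c"
proof -
  have p: "m < p" "0 < m" "0 < p" and q: "s < q" using assms(6-8) by (auto simp: m_def p_def q_def)
  show "0 < b" using p assms(6) by (simp add: b_def)
  have "s * m < q * p" using p q assms(6) by (intro mult_strict_mono) auto
  then show "0 < c" by (simp add: c_def mult.commute)
qed

text \<open>It suffices that \<open>c \<le> b * w\<close> with \<open>w = sqrt (m - 1)\<close>,
  because \<open>(b + c)\<^sup>2\<close> is at most \<open>2 * b\<^sup>2 + 2 * c\<^sup>2\<close>.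
  This in turn follows from \<open>q \<le> 2 * (s + 1) * w\<close>.\<close>

lemma extremal_vector_ratio:
  fixes n s l :: real
  defines "m \<equiv> n - 2 * s - 1" and "p \<equiv> l - n - s + 2" and "q \<equiv> l - 2 * n + s + 2"
  defines "b \<equiv> (s + 1) * (2 * p + s)" and "c \<equiv> p * q - s * m"
  assumes s: "1 \<le> s" and m: "5 \<le> m" and l: "2 * n \<le> l"
    and le: "(l - 2 * n + 3)\<^sup>2 \<le> 16 * (n - 4)"
  shows "(b + c)\<^sup>2 \<le> 2 * m * b\<^sup>2"
proof -
  have n: "2 * s + 6 \<le> n" using m by (simp add: m_def)
  have pos: "0 < b" "0 < c"
    using extremal_vector_positive[of s n l] s n l by (auto simp: b_def c_def p_def q_def m_def)
  have q0: "0 \<le> q" using s l by (simp add: q_def)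
  define w where "w = sqrt (m - 1)"
  have "2 \<le> w" unfolding w_def using m by (intro real_le_rsqrt) simp
  have ww: "w\<^sup>2 = m - 1" using m by (simp add: w_def)
  define Y where "Y = l - 2 * n + 3"
  \<comment> \<open>For \<open>s = 1\<close> this is the hypothesis, since then
    \<open>m - 1 = n - 4\<close>. The extra term covers larger \<open>s\<close> and is chosen so
    that \<open>q = Y + s - 1\<close> gets the bound \<open>2 * (s + 1) * w\<close>.\<close>
  have "Y \<le> 4 * w + (s - 1) * (2 * w - 1)"
  proof (rule power2_le_imp_le)
    have "Y\<^sup>2 \<le> 16 * w\<^sup>2 + 32 * (s - 1)"
      using le unfolding Y_def ww m_def by (simp add: algebra_simps)
    also have "\<dots> \<le> 16 * w\<^sup>2 + 8 * w * (s - 1) * (2 * w - 1)"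
    proof -
      have "2 * 3 \<le> w * (2 * w - 1)" using \<open>2 \<le> w\<close> by (intro mult_mono) auto
      then have "(s - 1) * 4 \<le> (s - 1) * (w * (2 * w - 1))" using s by (intro mult_left_mono) auto
      then show ?thesis by (simp add: algebra_simps)
    qed
    also have "\<dots> \<le> 16 * w\<^sup>2 + 8 * w * (s - 1) * (2 * w - 1) + ((s - 1) * (2 * w - 1))\<^sup>2" by simp
    also have "\<dots> = (4 * w + (s - 1) * (2 * w - 1))\<^sup>2" by (simp add: power2_eq_square algebra_simps)
    finally show "Y\<^sup>2 \<le> (4 * w + (s - 1) * (2 * w - 1))\<^sup>2" .
    show "0 \<le> 4 * w + (s - 1) * (2 * w - 1)"
      using \<open>2 \<le> w\<close> s by (intro add_nonneg_nonneg mult_nonneg_nonneg) auto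
  qed
  then have q: "q \<le> 2 * (s + 1) * w" unfolding Y_def q_def by (simp add: algebra_simps)
  \<comment> \<open>The second eigenvalue equation with the nonnegative contribution of the block
    \<open>S\<close> dropped.\<close>
  have "2 * (s + 1) * c \<le> b * q"
  proof -
    have "b * q - 2 * (s + 1) * c = (s + 1) * s * (q + 2 * m)" by (simp add: b_def c_def algebra_simps)
    moreover have "0 \<le> (s + 1) * s * (q + 2 * m)" using s q0 m by simp
    ultimately show ?thesis by linarith
  qed
  also have "b * q \<le> b * (2 * (s + 1) * w)" using q pos by (intro mult_left_mono) auto
  finally have "2 * (s + 1) * c \<le> 2 * (s + 1) * (b * w)" by (simp add: algebra_simps)
  then have "c \<le> b * w" using s by simp
  then have "c\<^sup>2 \<le> (b * w)\<^sup>2" using pos by (intro power_mono) auto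
  then have c2: "c\<^sup>2 \<le> b\<^sup>2 * (m - 1)" by (simp add: power_mult_distrib ww)
  have "(b + c)\<^sup>2 \<le> 2 * b\<^sup>2 + 2 * c\<^sup>2" using sum_squares_bound[of b c] by (simp add: power2_sum)
  then show ?thesis using c2 by (simp add: algebra_simps)
qed

theorem theorem1p3:
  fixes G :: "'a pair_pre_digraph" and vs :: "'a list" and n :: nat
  assumes "pair_graph G"
    and "Digraph_Component.connected (with_proj G)"
    and "distinct vs" and "set vs = pverts G"
    and "n = card (pverts G)" and "n \<ge> 4" and "even n"
    and "eta1 G vs < (if n = 4 \<or> n \<ge> 12 then theta n
                      else 2 * real n + sqrt (real n * (real n + 2) / 2) - 2)"
  shows "\<exists>M. perfect_matching G M"
proof (rule ccontr)
  assume no_matching: "\<nexists>M. perfect_matching G M"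
  interpret pair_graph G by (fact assms(1))
  let ?V = "pverts G" and ?Q = "distance_signless_laplacian G vs"
  define E where "E u v \<longleftrightarrow> (u, v) \<in> parcs G" for u v
  define l where "l = (if n = 4 \<or> n \<ge> 12 then theta n
                       else 2 * real n + sqrt (real n * (real n + 2) / 2) - 2)"
  have fin: "finite ?V" by (rule finite_verts)
  have "perfect_matching_on E ?V M \<longleftrightarrow> perfect_matching G M" for M
    by (simp add: perfect_matching_on_def perfect_matching_def undirected_edges_def E_def)
  then have noM: "\<nexists>M. perfect_matching_on E ?V M" using no_matching by simp
  have sym: "symp E" using arcs_symmetric by (auto simp: symp_def E_def)
  obtain S P where S: "S \<subseteq> ?V" and P: "separated_partition E (?V - S) P"
    and cardP: "card P = card S + 2" and odd: "\<And>C. C \<in> P \<Longrightarrow> odd (card C)"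
    using odd_separated_partition_if_no_perfect_matching[OF fin _ sym noM] assms(5,7) by blast
  note PU = separated_partitionD(1)[OF P] and Pne = separated_partitionD(2)[OF P]
    and Pdis = separated_partitionD(3)[OF P] and Psep = separated_partitionD(4)[OF P]
  have part: "partition_on (?V - S) P" using P by (simp add: separated_partition_def)
  define s where "s = card S"

  have "S \<noteq> {}"
  proof
    assume "S = {}"
    then have "card P = 2" using cardP by simp
    then obtain C D where CD: "P = {C, D}" "C \<noteq> D" by (auto simp: card_2_iff)
    have V: "C \<union> D = ?V" using PU CD \<open>S = {}\<close> by simp
    have "C = ?V"
    proof (rule connected_imp_closed_eq_pverts[OF assms(2)])
      show "C \<subseteq> ?V" "C \<noteq> {}" using V CD Pne by auto
      fix u v assume uv: "(u, v) \<in> parcs G" "u \<in> C"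
      have "v \<in> ?V" using uv(1) by (metis in_arcsD2)
      then show "v \<in> C" using V uv Psep[of C D u v] CD by (auto simp: E_def)
    qed
    then have "D = {}" using V CD Pdis[of C D] by auto
    then show False using CD Pne by simp
  qed
  then have s1: "1 \<le> s" using S fin by (simp add: s_def Suc_leI card_gt_0_iff finite_subset)
  \<comment> \<open>The \<open>s + 2\<close> nonempty parts have to fit into \<open>n - s\<close>
    vertices.\<close>
  have sn: "2 * s + 2 \<le> n"
  proof -
    have "card P \<le> card (?V - S)"
      using part fin by (intro card_partition_on_le) auto
    also have "\<dots> = n - s" using S fin by (simp add: card_Diff_subset finite_subset assms(5) s_def)
    finally show ?thesis using cardP by (simp add: s_def)
  qed
  note thr = threshold_properties[OF assms(6,7) s1 sn, folded l_def]

  define m p q where "m = real n - 2 * real s - 1" and "p = l - real n - real s + 2"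
    and "q = l - 2 * real n + real s + 2"
  define a b c where "a = (real s + 1) * (q + 2 * m)" and "b = (real s + 1) * (2 * p + real s)"
    and "c = p * q - real s * m"
  have s1': "1 \<le> real s" and sn': "2 * real s + 2 \<le> real n" using s1 sn by linarith+
  have c: "0 < c"
    using extremal_vector_positive(2)[OF s1' sn' thr(1)] by (simp add: c_def p_def q_def m_def)
  have ratio: "(b + c)\<^sup>2 \<le> 2 * m * b\<^sup>2" if m5: "5 \<le> m"
  proof -
    have "8 \<le> n" using m5 s1' by (simp add: m_def)
    from extremal_vector_ratio[OF s1' _ thr(1) thr(3)[OF this]] m5
    show ?thesis by (simp add: b_def c_def p_def q_def m_def)
  qed
  obtain x :: "'a \<Rightarrow> real" where norm: "(\<Sum>u\<in>?V. (x u)\<^sup>2) = real s * a\<^sup>2 + m * b\<^sup>2 + (real s + 1) * c\<^sup>2"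
    and form: "(real n - 2) * (real s * a\<^sup>2 + m * b\<^sup>2 + (real s + 1) * c\<^sup>2)
      + (real s * a + m * b + (real s + 1) * c)\<^sup>2
      + 2 * real s * (real s + 1) * c\<^sup>2 + m * (real s + 1) * (b + c)\<^sup>2
      \<le> (\<Sum>u\<in>?V. \<Sum>v\<in>?V. real (gdist G u v) * (x u + x v)\<^sup>2) / 2"
  proof (rule odd_partition_form_ge[OF fin S part cardP odd, of "\<lambda>u v. real (gdist G u v)" b c a])
    show "0 \<le> real (gdist G u v)" for u v by simp
    show "1 \<le> real (gdist G u v)" if "u \<in> ?V" "v \<in> ?V" "u \<noteq> v" for u v
      using gdist_ge(1)[OF assms(2) that] by simp
    show "2 \<le> real (gdist G u v)" if CD: "C \<in> P" "D \<in> P" "C \<noteq> D" "u \<in> C" "v \<in> D" for C D u v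
    proof -
      have "u \<in> ?V" "v \<in> ?V" using CD PU by blast+
      moreover have "u \<noteq> v" using Pdis[OF CD(1-3)] CD(4,5) by blast
      moreover have "(u, v) \<notin> parcs G" using Psep[OF CD] by (simp add: E_def)
      ultimately have "2 \<le> gdist G u v" using gdist_ge(2)[OF assms(2)] by blast
      then show ?thesis by simp
    qed
  qed (use ratio that in \<open>simp_all add: assms(5) s_def m_def\<close>)

  let ?x = "vec (length vs) (\<lambda>i. x (vs ! i))"
  have xx: "?x \<bullet> ?x = (\<Sum>u\<in>?V. (x u)\<^sup>2)"
    using sum_nth_distinct[OF assms(3), of "\<lambda>u. (x u)\<^sup>2"] assms(4)
    by (simp add: scalar_prod_def lessThan_atLeast0 power2_eq_square)
  have "0 < ?x \<bullet> ?x"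
    unfolding xx norm using c s1' sn' by (intro add_nonneg_pos add_nonneg_nonneg) (auto simp: m_def)
  then have x0: "?x \<noteq> 0\<^sub>v (length vs)" by auto
  \<comment> \<open>This is the excess of the lower bound for the form over \<open>l\<close> times
    the norm: \<open>c\<close> is positive and the cubic is nonpositive at the threshold.\<close>
  have "0 \<le> - ((real s + 1) * c * extremal_cubic (real n) (real s) l)"
    using c thr(2) by (simp add: mult_nonneg_nonpos)
  then have "l * (?x \<bullet> ?x) \<le> ?x \<bullet> (?Q *\<^sub>v ?x)"
    using form extremal_form_eq[of "real n" "real s" l]
    unfolding distance_signless_laplacian_form[OF assms(3,4)] xx norm
    by (simp add: a_def b_def c_def p_def q_def m_def)
  then have "l \<le> eta1 G vs"
    unfolding eta1_def using x0
    by (intro Max_spectrum_ge_Rayleigh[OF distance_signless_laplacian_carrier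
          distance_signless_laplacian_symmetric]) auto
  with assms(8) show False by (simp add: l_def)
qed

end
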